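(* Let $n>1$ and $1<p\le q<\infty$ be such that $\Theta(1):=1+n\left(\frac1q-\frac1p\right)>0$ and $q<n/\Theta(1)$. Let $0\le\delta<n(p-1)$. Then there exists $C>0$, depending only on $\delta,p,q$ and $n$, such that $$\left(\int_{\mathbb{R}^n}|f(x)|^q\,\mathcal{M}(g)(x)^{\Theta(1)q/n}\,|x|^{q\delta/p}\,dx\right)^{1/q}\le C\,\|g\|_{L^1(\mathbb{R}^n)}^{\Theta(1)/n}\left(\int_{\mathbb{R}^n}|\nabla f(x)|^p|x|^\delta\,dx\right)^{1/p}$$ for every $f\in C_0^1(\mathbb{R}^n)$ and $g\in L^1(\mathbb{R}^n)$.
   Context: $\mathcal{M}(g)(x)=\sup_{Q\ni x}\frac1{|Q|}\int_Q|g|$ is the Hardy--Littlewood maximal function, the supremum being over cubes $Q\subset\mathbb{R}^n$ with sides parallel to the coordinate axes containing $x$. $C_0^1(\mathbb{R}^n)$ is the set of continuously differentiable functions on $\mathbb{R}^n$ vanishing at infinity. *)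

theory Defs
  imports "HOL-Analysis.Analysis"
begin

text \<open>Real powers on the extended half-line, used for exponents \<open>a > 0\<close> only: then
  \<open>0\<close> is mapped to \<open>0\<close> and \<open>\<infinity>\<close> to \<open>\<infinity>\<close>.\<close>

definition ennreal_powr :: "ennreal \<Rightarrow> real \<Rightarrow> ennreal" where
  "ennreal_powr x a = (if x = \<infinity> then \<infinity> else ennreal (enn2real x powr a))"

definition axis_cubes :: "(real ^ 'n::finite) set set" where
  "axis_cubes = {cbox a (a + (\<chi> i. s)) | a s. 0 < s}"

definition hl_maximal :: "(real ^ 'n::finite \<Rightarrow> real) \<Rightarrow> real ^ 'n \<Rightarrow> ennreal" where
  "hl_maximal g x =
     (SUP Q \<in> {Q \<in> axis_cubes. x \<in> Q}.
        (\<integral>\<^sup>+ y \<in> Q. ennreal \<bar>g y\<bar> \<partial>lebesgue) / emeasure lebesgue Q)"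

definition gradient :: "('a::real_inner \<Rightarrow> real) \<Rightarrow> 'a \<Rightarrow> 'a" where
  "gradient f x = (THE D. GDERIV f x :> D)"

definition C01 :: "('a::euclidean_space \<Rightarrow> real) set" where
  "C01 = {f. (\<forall>x. f differentiable (at x)) \<and> continuous_on UNIV (gradient f)
             \<and> (f \<longlongrightarrow> 0) at_infinity}"

definition Theta1 :: "nat \<Rightarrow> real \<Rightarrow> real \<Rightarrow> real" where
  "Theta1 n p q = 1 + real n * (1 / q - 1 / p)"

end

theory Submission
  imports Defs "HOL-Real_Asymp.Real_Asymp"
begin

text \<open>The hypothesis \<open>q < n / \<Theta>(1)\<close> amounts to \<open>p < n\<close>. Put \<open>a = \<delta>/p\<close> and \<open>\<gamma> = \<Theta>(1) q / n < 1\<close>. By the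
  weak type (1,1) bound, \<open>\<integral>\<^sub>E M(g)\<^sup>\<gamma> \<le> C \<parallel>g\<parallel>\<^sub>1\<^sup>\<gamma> |E|\<^sup>1\<^sup>-\<^sup>\<gamma>\<close> for every set \<open>E\<close>. Hardy's inequality
  \<open>\<parallel>|x|\<^sup>a\<^sup>-\<^sup>1 f\<parallel>\<^sub>p \<le> C \<parallel>|x|\<^sup>a \<nabla>f\<parallel>\<^sub>p\<close> bounds the gradient of \<open>G = |x|\<^sup>a f\<close> in \<open>L\<^sup>p\<close>, which reduces the theorem to
  the unweighted case: \<open>\<integral> |G|\<^sup>q M(g)\<^sup>\<gamma>\<close> is controlled by the embedding into the Lorentz space \<open>L\<^sup>p\<^sup>*\<^sup>,\<^sup>q\<close>, which is
  obtained from the weak type Sobolev inequality by truncating \<open>G\<close> at dyadic levels.\<close>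

section \<open>The maximal function\<close>

text \<open>Let P be the Sobolev exponent, 1/P = 1/p - 1/n. Then 1 - \<gamma> = q/P, and
  M(g)^\<gamma> lies only in weak L^s with s = 1/\<gamma>, whereas Hoelder's inequality with |G|^q
  in L^(P/q) would ask for strong L^s. The missing summability over dyadic levels comes from the
  gradient: its p-th power splits into shares m_k, one for each height 2^k, whose sum is at most a
  multiple of the whole; level k contributes m_k^(q/p), and q \<ge> p makes these contributions
  summable. Two features of the functions shape the statements. The weight need not be
  differentiable at 0, so derivatives are demanded only off 0 and the lines of integration have to
  avoid 0. The functions merely vanish at infinity, so their values are recovered by integrating
  derivatives along rays to infinity. Integrals are bounded by a real number N, so that finiteness
  is part of each hypothesis and an infinite right-hand side is dealt with only once, at the
  end.\<close>

text \<open>Comparing \<open>s\<close> with a power of 2 turns the terms into a two-sided geometric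
  sequence, whence uniformity in \<open>s\<close>. It serves to sum over the levels of the maximal
  function and over the levels of \<open>G\<close>. The sum is an integral over
  \<open>count_space\<close>, so that Tonelli's theorem exchanges it with Lebesgue
  integrals.\<close>

lemma int_geometric_bound:
  fixes e :: real
  assumes e: "e > 0"
  obtains C where "C > 0" "\<And>s. s > 0 \<Longrightarrow>
    (\<integral>\<^sup>+k. ennreal (min (2 powr of_int k * s) (1 / (2 powr of_int k * s)) powr e)
       \<partial>count_space (UNIV::int set)) \<le> ennreal C"
proof
  \<comment> \<open>The 1 in the exponent pays for rounding \<open>s\<close> down to
    \<open>2 powr j\<close>; \<open>S\<close> is the sum of \<open>f\<close> over either
    half-line.\<close>
  define f where "f k = ennreal (2 powr (e * (1 - \<bar>of_int k\<bar>)))" for k :: int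
  define x where "x = 2 powr (- e)"
  define S where "S = 2 powr e * (1 / (1 - x))"
  have x: "0 < x" "x < 1"
    using e by (auto simp: x_def powr_less_one)
  have S: "S > 0" using x by (auto simp: S_def)
  have half: "(\<integral>\<^sup>+k. f k * indicator (range g) k \<partial>count_space UNIV) = ennreal S"
    if g: "inj g" "\<And>n. \<bar>g n\<bar> = int n" for g :: "nat \<Rightarrow> int"
  proof -
    have "(\<integral>\<^sup>+k. f k * indicator (range g) k \<partial>count_space UNIV) = (\<integral>\<^sup>+k. f k \<partial>count_space (range g))"
      by (simp add: nn_integral_count_space_indicator)
    also have "\<dots> = (\<integral>\<^sup>+n. f (g n) \<partial>count_space UNIV)"
      by (rule nn_integral_bij_count_space[symmetric]) (use g in \<open>auto simp: bij_betw_def\<close>)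
    also have "\<dots> = (\<Sum>n. f (g n))"
      by (rule nn_integral_count_space_nat)
    also have "f (g n) = ennreal (2 powr e * x ^ n)" for n
    proof -
      have "\<bar>real_of_int (g n)\<bar> = real n" using g(2)[of n] by linarith
      then show ?thesis
        by (simp add: f_def x_def powr_add[symmetric] right_diff_distrib powr_powr powr_realpow[symmetric])
    qed
    then have "(\<Sum>n. f (g n)) = (\<Sum>n. ennreal (2 powr e * x ^ n))" by simp
    also have "\<dots> = ennreal S"
      unfolding S_def using x
      by (intro suminf_ennreal_eq sums_mult geometric_sums) auto
    finally show ?thesis .
  qed
  show "2 * S > 0" using S by simp
  fix s :: real assume s: "s > 0"
  define j where "j = \<lfloor>log 2 s\<rfloor>"
  have j1: "2 powr of_int j \<le> s"
    using s by (simp add: j_def powr_le_iff)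
  have j2: "s \<le> 2 powr (of_int j + 1)"
    using s by (simp add: j_def le_powr_iff)
  have le: "ennreal (min (2 powr of_int k * s) (1 / (2 powr of_int k * s)) powr e) \<le> f (k + j)" for k
  proof -
    have "min (2 powr of_int k * s) (1 / (2 powr of_int k * s)) \<le> 2 powr (1 - \<bar>of_int (k + j)\<bar>)"
    proof (cases "k + j \<ge> 0")
      case True
      have "2 powr of_int (k + j) \<le> 2 powr of_int k * s"
        using mult_left_mono[OF j1, of "2 powr of_int k"] by (simp add: powr_add)
      then have "1 / (2 powr of_int k * s) \<le> 1 / 2 powr of_int (k + j)"
        using s by (intro divide_left_mono) auto
      also have "\<dots> = 2 powr (- of_int (k + j))" by (simp add: powr_minus_divide del: of_int_add)
      also have "\<dots> \<le> 2 powr (1 - \<bar>of_int (k + j)\<bar>)" using True by (intro powr_mono) linarith+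
      finally show ?thesis by linarith
    next
      case False
      have "2 powr of_int k * s \<le> 2 powr of_int k * 2 powr (of_int j + 1)"
        by (intro mult_left_mono j2) auto
      also have "\<dots> = 2 powr (1 - \<bar>of_int (k + j)\<bar>)" 
        unfolding powr_add[symmetric] using False by (intro arg_cong2[of _ _ _ _ "(powr)"]) linarith+
      finally show ?thesis by linarith
    qed
    then have "min (2 powr of_int k * s) (1 / (2 powr of_int k * s)) powr e \<le> (2 powr (1 - \<bar>of_int (k + j)\<bar>)) powr e"
      using s e by (intro powr_mono2) auto
    then show ?thesis
      unfolding f_def by (intro ennreal_leI) (simp add: powr_powr mult.commute)
  qed
  have "(\<integral>\<^sup>+k. ennreal (min (2 powr of_int k * s) (1 / (2 powr of_int k * s)) powr e)
       \<partial>count_space (UNIV::int set)) \<le> (\<integral>\<^sup>+k. f (k + j) \<partial>count_space UNIV)"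
    by (intro nn_integral_mono le)
  also have "\<dots> = (\<integral>\<^sup>+k. f k \<partial>count_space UNIV)"
    by (rule nn_integral_bij_count_space)
       (auto simp: bij_betw_def inj_on_def intro!: surjI[of _ "\<lambda>k. k - j"])
  also have "\<dots> \<le> (\<integral>\<^sup>+k. f k * indicator (range int) k + f k * indicator (range (\<lambda>n. - int n)) k \<partial>count_space UNIV)"
  proof (intro nn_integral_mono)
    fix k :: int
    have "k \<in> range int \<or> k \<in> range (\<lambda>n. - int n)"
      by (cases k rule: int_cases) (auto simp del: of_nat_Suc)
    then show "f k \<le> f k * indicator (range int) k + f k * indicator (range (\<lambda>n. - int n)) k"
      by (auto simp: indicator_def)
  qed
  also have "\<dots> = ennreal S + ennreal S"
    by (subst nn_integral_add) (auto simp: half inj_on_def)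
  also have "\<dots> = ennreal (2 * S)" using S by (simp flip: ennreal_plus)
  finally show "(\<integral>\<^sup>+k. ennreal (min (2 powr of_int k * s) (1 / (2 powr of_int k * s)) powr e)
       \<partial>count_space (UNIV::int set)) \<le> ennreal (2 * S)" .
qed

section \<open>The weak type (1,1) bound by Vitali covering\<close>

text \<open>Cubes are traded for balls centred at the given point, the form in which the Vitali
  covering lemma is applied. The factor \<open>CARD('n)\<close> comes from bounding the Euclidean
  norm by the sum of the absolute coordinates.\<close>

lemma axis_cube_subset_cball:
  fixes x :: "real ^ 'n::finite"
  assumes "Q \<in> axis_cubes" "x \<in> Q"
  obtains s where "s > 0" "Q \<in> sets borel" "emeasure lebesgue Q = ennreal (s ^ CARD('n))"
    "Q \<subseteq> cball x (real CARD('n) * s)"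
proof -
  obtain a :: "real ^ 'n" and s where Q: "Q = cbox a (a + (\<chi> i. s))" and s: "s > 0"
    using assms(1) by (auto simp: axis_cubes_def)
  have "measure lborel Q = s ^ CARD('n)"
    using assms(2) unfolding Q by (subst content_cbox_cart) auto
  moreover have "emeasure lborel Q = ennreal (measure lborel Q)"
    unfolding Q using emeasure_lborel_cbox_finite[of a] by (intro emeasure_eq_ennreal_measure) (simp add: less_top[symmetric])
  ultimately have em: "emeasure lebesgue Q = ennreal (s ^ CARD('n))"
    unfolding Q by simp
  have sub: "Q \<subseteq> cball x (real CARD('n) * s)"
  proof
    fix y assume y: "y \<in> Q"
    have "dist x y \<le> (\<Sum>i\<in>UNIV. \<bar>(x - y) $ i\<bar>)"
      unfolding dist_norm by (rule norm_le_l1_cart)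
    also have "\<dots> \<le> (\<Sum>i\<in>(UNIV::'n set). s)"
    proof (rule sum_mono)
      fix i
      show "\<bar>(x - y) $ i\<bar> \<le> s"
        using assms(2) y unfolding Q mem_box_cart by (auto simp: abs_le_iff dest!: spec[of _ i])
    qed
    finally show "y \<in> cball x (real CARD('n) * s)" by simp
  qed
  show ?thesis using that[OF s _ em sub] unfolding Q by simp
qed

text \<open>Each point of the superlevel set is the centre of a ball whose |g|-mass is comparable to
  \<open>lam\<close> times its volume, and disjoint balls have total mass at most the norm of
  \<open>g\<close>. The factor 5 is Vitali's dilation, \<open>CARD('n)\<close> the passage from
  cubes to balls. The open set \<open>U\<close> stands in for the superlevel set, so that only
  measures of Borel sets occur.\<close>

lemma hl_maximal_superlevel:
  fixes g :: "real ^ 'n::finite \<Rightarrow> real"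
  assumes g: "integrable lebesgue g" and lam: "lam > 0"
  obtains U where "open U" "{x. ennreal lam < hl_maximal g x} \<subseteq> U"
    "emeasure lborel U \<le> ennreal (unit_ball_vol (real CARD('n)) * (5 * real CARD('n)) ^ CARD('n)
       * (LINT x|lebesgue. \<bar>g x\<bar>) / lam)"
proof -
  let ?n = "CARD('n)"
  define A where "A = (LINT x|lebesgue. \<bar>g x\<bar>)"
  define I where "I S = (\<integral>\<^sup>+y\<in>S. ennreal \<bar>g y\<bar> \<partial>lebesgue)" for S
  have [measurable]: "g \<in> borel_measurable lebesgue" using g by auto
  have tot: "(\<integral>\<^sup>+y. ennreal \<bar>g y\<bar> \<partial>lebesgue) = ennreal A"
    unfolding A_def using g by (intro nn_integral_eq_integral) auto
  have I_le: "I S \<le> ennreal A" for S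
    unfolding I_def tot[symmetric] by (intro nn_integral_mono) (auto simp: indicator_def)
  have A0: "A \<ge> 0" unfolding A_def by simp
  define K where "K = {x. ennreal lam < hl_maximal g x}"
  have "\<exists>s>0. ennreal (lam * s ^ ?n) \<le> I (cball x (real ?n * s))" if x: "x \<in> K" for x
  proof -
    obtain Q where Q: "Q \<in> axis_cubes" "x \<in> Q" and l: "ennreal lam < I Q / emeasure lebesgue Q"
      using x unfolding K_def hl_maximal_def I_def by (auto simp: less_SUP_iff)
    obtain s where s: "s > 0" "Q \<in> sets borel" "emeasure lebesgue Q = ennreal (s ^ ?n)"
      "Q \<subseteq> cball x (real ?n * s)"
      using axis_cube_subset_cball[OF Q] .
    obtain i where i: "I Q = ennreal i" "i \<ge> 0"
      using I_le[of Q] by (cases "I Q") (auto simp: top_unique)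
    have "lam < i / s ^ ?n"
      using l lam s(1) i by (simp add: s(3) divide_ennreal ennreal_less_iff)
    then have "ennreal (lam * s ^ ?n) \<le> I Q"
      using s(1) i by (simp add: field_simps)
    also have "\<dots> \<le> I (cball x (real ?n * s))"
      unfolding I_def using s(4) by (intro nn_integral_mono) (auto simp: indicator_def)
    finally show ?thesis using s(1) by blast
  qed
  then obtain s where s: "\<And>x. x \<in> K \<Longrightarrow> s x > 0"
    "\<And>x. x \<in> K \<Longrightarrow> ennreal (lam * s x ^ ?n) \<le> I (cball x (real ?n * s x))"
    by metis
  define r where "r x = real ?n * s x" for x
  \<comment> \<open>The total mass \<open>A\<close> bounds the side of every selected cube by
    \<open>T\<close>; the covering lemma asks for bounded radii.\<close>
  define T where "T = root ?n (A / lam)"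
  have "0 < r x \<and> r x \<le> real ?n * T" if "x \<in> K" for x
  proof -
    have "ennreal (lam * s x ^ ?n) \<le> ennreal A"
      using s(2)[OF that] I_le order_trans by blast
    then have "s x ^ ?n \<le> A / lam"
      using lam A0 by (simp add: field_simps)
    then have "root ?n (s x ^ ?n) \<le> T"
      unfolding T_def by (intro real_root_le_mono) auto
    then show ?thesis using s(1)[OF that] by (simp add: r_def real_root_power_cancel)
  qed
  then obtain C where C: "countable C" "C \<subseteq> K"
    "pairwise (\<lambda>i j. disjnt (cball i (r i)) (cball j (r j))) C"
    "\<And>i. i \<in> K \<Longrightarrow> \<exists>j. j \<in> C \<and> \<not> disjnt (cball i (r i)) (cball j (r j))
        \<and> cball i (r i) \<subseteq> ball j (5 * r j)"
    by (rule Vitali_covering_lemma_cballs_balls[where a = "\<lambda>x. x"]) blast+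
  define c where "c = unit_ball_vol (real ?n) * (5 * real ?n) ^ ?n"
  have c0: "c > 0" by (simp add: c_def)
  define U where "U = (\<Union>j\<in>C. ball j (5 * r j))"
  have sub: "K \<subseteq> U"
  proof
    fix x assume "x \<in> K"
    obtain j where j: "j \<in> C" "cball x (r x) \<subseteq> ball j (5 * r j)"
      using C(4)[OF \<open>x \<in> K\<close>] by blast
    have "x \<in> cball x (r x)" using s(1)[OF \<open>x \<in> K\<close>] by (simp add: r_def)
    then show "x \<in> U" unfolding U_def using j by blast
  qed
  have "emeasure lborel U \<le> (\<integral>\<^sup>+j. emeasure lborel (ball j (5 * r j)) \<partial>count_space C)"
  proof -
    have "emeasure lborel U = (\<integral>\<^sup>+x. indicator U x \<partial>lborel)"
      unfolding U_def by (subst nn_integral_indicator) (auto intro: borel_open open_UN)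
    also have "\<dots> \<le> (\<integral>\<^sup>+x. \<integral>\<^sup>+j. indicator (ball j (5 * r j)) x \<partial>count_space C \<partial>lborel)"
    proof (intro nn_integral_mono)
      fix x
      show "indicator U x \<le> (\<integral>\<^sup>+j. indicator (ball j (5 * r j)) x \<partial>count_space C)"
      proof (cases "x \<in> U")
        case True
        then obtain j where j: "j \<in> C" "x \<in> ball j (5 * r j)" unfolding U_def by blast
        show ?thesis
          using nn_integral_ge_point[OF j(1), of "\<lambda>j. indicator (ball j (5 * r j)) x"] j(2) True by simp
      qed simp
    qed
    also have "\<dots> = (\<integral>\<^sup>+j. \<integral>\<^sup>+x. indicator (ball j (5 * r j)) x \<partial>lborel \<partial>count_space C)"
      by (intro nn_integral_count_space_nn_integral C(1)) (auto intro!: borel_measurable_indicator)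
    finally show ?thesis by simp
  qed
  also have "\<dots> \<le> (\<integral>\<^sup>+j. ennreal (c / lam) * I (cball j (r j)) \<partial>count_space C)"
  proof (intro nn_integral_mono)
    fix j assume "j \<in> space (count_space C)"
    then have j: "j \<in> K" using C(2) by auto
    then have sj: "s j > 0" using s by auto
    have "emeasure lborel (ball j (5 * r j)) = ennreal (c / lam * (lam * s j ^ ?n))"
      using sj lam by (simp add: emeasure_ball r_def c_def power_mult_distrib algebra_simps)
    also have "\<dots> = ennreal (c / lam) * ennreal (lam * s j ^ ?n)"
      using c0 lam sj by (intro ennreal_mult) auto
    also have "\<dots> \<le> ennreal (c / lam) * I (cball j (r j))"
      using s(2)[OF j] unfolding r_def by (intro mult_left_mono) auto
    finally show "emeasure lborel (ball j (5 * r j)) \<le> ennreal (c / lam) * I (cball j (r j))" .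
  qed
  also have "\<dots> = ennreal (c / lam) * (\<integral>\<^sup>+j. I (cball j (r j)) \<partial>count_space C)"
    by (rule nn_integral_cmult) auto
  \<comment> \<open>Seen as values of one measure with density |g|, the masses of the disjoint balls
    add up to at most \<open>A\<close>.\<close>
  also have "(\<integral>\<^sup>+j. I (cball j (r j)) \<partial>count_space C)
      = (\<integral>\<^sup>+j. emeasure (density lebesgue (\<lambda>y. ennreal \<bar>g y\<bar>)) (cball j (r j)) \<partial>count_space C)"
    unfolding I_def by (intro nn_integral_cong) (simp add: emeasure_density)
  also have "\<dots> = emeasure (density lebesgue (\<lambda>y. ennreal \<bar>g y\<bar>)) (\<Union>j\<in>C. cball j (r j))"
    using C(1,3) by (intro emeasure_UN_countable[symmetric])
      (auto simp: disjoint_family_on_def pairwise_def disjnt_def)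
  also have "\<dots> \<le> emeasure (density lebesgue (\<lambda>y. ennreal \<bar>g y\<bar>)) (space lebesgue)"
    by (metis emeasure_space space_density)
  also have "\<dots> = ennreal A"
    by (subst emeasure_density) (auto simp: tot)
  finally have "emeasure lborel U \<le> ennreal (c / lam) * ennreal A"
    by (simp add: mult_left_mono)
  also have "\<dots> = ennreal (c * A / lam)"
    using c0 lam A0 by (subst ennreal_mult[symmetric]) auto
  finally show ?thesis
    using that[of U] sub unfolding c_def A_def K_def by (auto simp: U_def)
qed

text \<open>Kolmogorov's inequality for \<open>M(g)\<^sup>\<gamma>\<close>. It is stated for a dyadic Borel majorant \<open>V\<close>, so that
  measurability of the maximal function is not an issue.\<close>

lemma hl_maximal_powr_majorant:
  fixes \<gamma> :: real
  assumes \<gamma>: "0 < \<gamma>" "\<gamma> < 1"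
  obtains K where "K > 0"
    "\<And>g :: real ^ 'n::finite \<Rightarrow> real. integrable lebesgue g \<Longrightarrow> (LINT x|lebesgue. \<bar>g x\<bar>) > 0 \<Longrightarrow>
      \<exists>V \<in> borel_measurable borel. (\<forall>x. ennreal_powr (hl_maximal g x) \<gamma> \<le> V x) \<and>
        (\<forall>E m. E \<in> sets borel \<longrightarrow> m > 0 \<longrightarrow> emeasure lborel E \<le> ennreal m \<longrightarrow>
          (\<integral>\<^sup>+x. V x * indicator E x \<partial>lborel)
            \<le> ennreal (K * (LINT x|lebesgue. \<bar>g x\<bar>) powr \<gamma> * m powr (1 - \<gamma>)))"
proof -
  define c where "c = unit_ball_vol (real CARD('n)) * (5 * real CARD('n)) ^ CARD('n)"
  have c0: "c > 0" by (simp add: c_def)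
  \<comment> \<open>With u = 2^k m / (c A), the k-th term of the estimate behaves like u^\<gamma>
    for u \<le> 1 and like u^(\<gamma> - 1) for u > 1; \<open>e\<close> is the slower of the two
    rates of decay.\<close>
  define e where "e = min \<gamma> (1 - \<gamma>)"
  have e0: "e > 0" using \<gamma> by (auto simp: e_def)
  obtain C where C: "C > 0" "\<And>s. s > 0 \<Longrightarrow>
    (\<integral>\<^sup>+k. ennreal (min (2 powr of_int k * s) (1 / (2 powr of_int k * s)) powr e)
       \<partial>count_space (UNIV::int set)) \<le> ennreal C"
    using int_geometric_bound[OF e0] by blast
  define K where "K = 2 powr \<gamma> * c powr \<gamma> * C"
  have K0: "K > 0" using c0 C(1) by (simp add: K_def)
  show ?thesis
  proof (rule that[OF K0])
    fix g :: "real ^ 'n \<Rightarrow> real"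
    assume g: "integrable lebesgue g"
    define A where "A = (LINT x|lebesgue. \<bar>g x\<bar>)"
    assume "(LINT x|lebesgue. \<bar>g x\<bar>) > 0"
    then have A0: "A > 0" by (simp add: A_def)
    have "\<exists>U. open U \<and> {x. ennreal (2 powr of_int k) < hl_maximal g x} \<subseteq> U \<and>
        emeasure lborel U \<le> ennreal (c * A / 2 powr of_int k)" for k :: int
      using hl_maximal_superlevel[OF g, of "2 powr of_int k"] unfolding c_def A_def
      by (metis powr_gt_zero zero_neq_numeral)
    then obtain U where U: "\<And>k. open (U k)"
      "\<And>k x. ennreal (2 powr of_int k) < hl_maximal g x \<Longrightarrow> x \<in> U k"
      "\<And>k. emeasure lborel (U k) \<le> ennreal (c * A / 2 powr of_int k)"
      by (metis (no_types, lifting) mem_Collect_eq subsetD)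
    have U_sets [measurable]: "U k \<in> sets borel" for k using U(1) by auto
    \<comment> \<open>Where 2^k < M(g) \<le> 2^(k+1), the single term \<open>k\<close> already
      dominates M(g)^\<gamma>; this is the origin of \<open>k + 1\<close> in the exponent.\<close>
    define V where "V x = (\<integral>\<^sup>+k. ennreal (2 powr (\<gamma> * (of_int k + 1))) * indicator (U k) x
      \<partial>count_space (UNIV::int set))" for x
    have V_ge: "ennreal (2 powr (\<gamma> * (of_int k + 1))) \<le> V x" if "x \<in> U k" for k x
      using nn_integral_ge_point[of k UNIV "\<lambda>k. ennreal (2 powr (\<gamma> * (of_int k + 1))) * indicator (U k) x"] that
      by (simp add: V_def)
    have V_meas: "V \<in> borel_measurable borel"
      unfolding V_def 
      by (intro sigma_finite_measure.borel_measurable_nn_integral sigma_finite_measure_count_space)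
         measurable
    have maj: "ennreal_powr (hl_maximal g x) \<gamma> \<le> V x" for x
    proof (cases "hl_maximal g x")
      case top
      \<comment> \<open>Such a point lies in every \<open>U k\<close>, so \<open>V x\<close> exceeds
        terms that grow without bound in \<open>k\<close>.\<close>
      have "V x = top"
      proof (rule ccontr)
        assume "V x \<noteq> top"
        then obtain v where v: "V x = ennreal v" "v \<ge> 0" by (cases "V x") auto
        have v1: "2 powr (\<gamma> * (of_int k + 1)) \<le> v" for k :: int
        proof -
          have "ennreal (2 powr (\<gamma> * (of_int k + 1))) \<le> ennreal v"
            unfolding v(1)[symmetric] by (intro V_ge U(2)) (simp add: top)
          then show ?thesis using v(2) by simp
        qed
        define k where "k = \<lceil>log 2 (v + 1) / \<gamma>\<rceil>"
        have "log 2 (v + 1) / \<gamma> \<le> of_int k + 1" unfolding k_def by linarith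
        then have "log 2 (v + 1) \<le> \<gamma> * (of_int k + 1)"
          using \<gamma> by (simp add: field_simps)
        then have "v + 1 \<le> 2 powr (\<gamma> * (of_int k + 1))"
          using v(2) by (simp add: log_le_iff)
        with v1[of k] show False by linarith
      qed
      then show ?thesis by simp
    next
      case (real h)
      show ?thesis
      proof (cases "h = 0")
        case True
        then show ?thesis using real by (simp add: ennreal_powr_def)
      next
        case False
        with real have h: "h > 0" by simp
        \<comment> \<open>Ceiling minus 1, rather than the floor, gives the strict inequality 2^k <
          h required for membership in \<open>U k\<close>.\<close>
        define k where "k = \<lceil>log 2 h\<rceil> - 1"
        have "of_int k < log 2 h" "log 2 h \<le> of_int k + 1" unfolding k_def by linarith+
        then have k: "2 powr of_int k < h" "h \<le> 2 powr (of_int k + 1)"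
          using h by (simp_all add: less_log_iff log_le_iff)
        have "ennreal_powr (hl_maximal g x) \<gamma> = ennreal (h powr \<gamma>)"
          using real by (simp add: ennreal_powr_def)
        also have "\<dots> \<le> ennreal ((2 powr (of_int k + 1)) powr \<gamma>)"
          using h k \<gamma> by (intro ennreal_leI powr_mono2) auto
        also have "\<dots> = ennreal (2 powr (\<gamma> * (of_int k + 1)))"
          by (simp add: powr_powr mult.commute)
        also have "\<dots> \<le> V x"
          using k(1) real by (intro V_ge U(2)) (simp add: ennreal_less_iff)
        finally show ?thesis .
      qed
    qed
    have bound: "(\<integral>\<^sup>+x. V x * indicator E x \<partial>lborel) \<le> ennreal (K * A powr \<gamma> * m powr (1 - \<gamma>))"
      if E[measurable]: "E \<in> sets borel" and m: "m > 0" "emeasure lborel E \<le> ennreal m" for E m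
    proof -
      \<comment> \<open>The two bounds for the measure of \<open>U k \<inter> E\<close>, namely
        \<open>m\<close> and c A / 2^k, coincide when 2^k s = 1.\<close>
      define s where "s = m / (c * A)"
      have s0: "s > 0" using m c0 A0 by (simp add: s_def)
      define L where "L = 2 powr \<gamma> * (c * A) powr \<gamma> * m powr (1 - \<gamma>)"
      have L0: "L \<ge> 0" by (simp add: L_def)
      have "(\<integral>\<^sup>+x. V x * indicator E x \<partial>lborel) =
        (\<integral>\<^sup>+x. \<integral>\<^sup>+k. ennreal (2 powr (\<gamma> * (of_int k + 1))) * indicator (U k) x * indicator E x
          \<partial>count_space (UNIV::int set) \<partial>lborel)"
        unfolding V_def by (intro nn_integral_cong nn_integral_multc[symmetric]) auto
      also have "\<dots> = (\<integral>\<^sup>+k. \<integral>\<^sup>+x. ennreal (2 powr (\<gamma> * (of_int k + 1))) * indicator (U k) x * indicator E x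
           \<partial>lborel \<partial>count_space (UNIV::int set))"
        by (intro nn_integral_count_space_nn_integral) auto
      also have "\<dots> = (\<integral>\<^sup>+k. ennreal (2 powr (\<gamma> * (of_int k + 1))) * emeasure lborel (U k \<inter> E)
           \<partial>count_space (UNIV::int set))"
        by (intro nn_integral_cong)
          (simp add: mult.assoc nn_integral_cmult indicator_inter_arith[symmetric])
      also have "\<dots> \<le> (\<integral>\<^sup>+k. ennreal L *
          ennreal (min (2 powr of_int k * s) (1 / (2 powr of_int k * s)) powr e) \<partial>count_space (UNIV::int set))"
      proof (intro nn_integral_mono)
        fix k :: int
        define u where "u = 2 powr of_int k * s"
        have u0: "u > 0" using s0 by (simp add: u_def)
        have m_eq: "m = u * (c * A) / 2 powr of_int k"
          using c0 A0 by (simp add: u_def s_def)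
        have "emeasure lborel (U k \<inter> E) \<le> ennreal (min m (c * A / 2 powr of_int k))"
        proof -
          have "emeasure lborel (U k \<inter> E) \<le> emeasure lborel (U k)"
            "emeasure lborel (U k \<inter> E) \<le> emeasure lborel E" by (intro emeasure_mono; auto)+
          then show ?thesis using U(3)[of k] m(2) by (auto simp: min_def intro: order_trans)
        qed
        then have "ennreal (2 powr (\<gamma> * (of_int k + 1))) * emeasure lborel (U k \<inter> E)
          \<le> ennreal (2 powr (\<gamma> * (of_int k + 1))) * ennreal (min m (c * A / 2 powr of_int k))"
          by (intro mult_left_mono) auto
        also have "\<dots> = ennreal (2 powr (\<gamma> * (of_int k + 1)) * min m (c * A / 2 powr of_int k))"
          using m c0 A0 by (intro ennreal_mult[symmetric]) auto
        also have "\<dots> \<le> ennreal (L * min u (1 / u) powr e)"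
        proof (intro ennreal_leI)
          have min_eq: "min m (c * A / 2 powr of_int k) = m * min 1 (1 / u)"
            using m c0 A0 u0 unfolding u_def s_def by (auto simp: min_def field_simps)
          \<comment> \<open>After the required power of \<open>m\<close> is split off, the remaining
            \<open>m powr \<gamma>\<close> is expressed through \<open>u\<close>, which cancels the
            factor 2^(\<gamma> k) of the level.\<close>
          have "m powr (1 - \<gamma>) * m powr \<gamma> = m"
            using m by (simp flip: powr_add)
          moreover have "m powr \<gamma> = u powr \<gamma> * (c * A) powr \<gamma> / 2 powr (\<gamma> * of_int k)"
            using u0 c0 A0 unfolding m_eq by (simp add: powr_mult powr_divide powr_powr mult.commute)
          ultimately have m_powr: "m = m powr (1 - \<gamma>) * (u powr \<gamma> * (c * A) powr \<gamma> / 2 powr (\<gamma> * of_int k))"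
            by simp
          have eq: "2 powr (\<gamma> * (of_int k + 1)) * min m (c * A / 2 powr of_int k)
            = L * (u powr \<gamma> * min 1 (1 / u))"
            unfolding min_eq by (subst m_powr) (simp add: L_def powr_add distrib_left)
          have "u powr \<gamma> * min 1 (1 / u) \<le> min u (1 / u) powr e"
          proof (cases "u \<le> 1")
            case True
            have "u powr \<gamma> \<le> u powr e"
              using u0 True by (intro powr_mono') (auto simp: e_def)
            moreover have "u * u \<le> 1" using True u0 by (intro mult_le_one) auto
            ultimately show ?thesis using True u0 by (auto simp: min_def field_simps)
          next
            case False
            have "u powr \<gamma> * (1 / u) = (1 / u) powr (1 - \<gamma>)"
              using u0 by (simp add: powr_divide powr_diff)
            also have "\<dots> \<le> (1 / u) powr e"
              using u0 False by (intro powr_mono') (auto simp: e_def)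
            finally show ?thesis using False u0 less_1_mult[of u u] by (auto simp: min_def field_simps)
          qed
          then show "2 powr (\<gamma> * (of_int k + 1)) * min m (c * A / 2 powr of_int k) \<le> L * min u (1 / u) powr e"
            unfolding eq using L0 by (intro mult_left_mono) auto
        qed
        also have "\<dots> = ennreal L * ennreal (min u (1 / u) powr e)"
          using L0 by (intro ennreal_mult) auto
        finally show "ennreal (2 powr (\<gamma> * (of_int k + 1))) * emeasure lborel (U k \<inter> E)
          \<le> ennreal L * ennreal (min (2 powr of_int k * s) (1 / (2 powr of_int k * s)) powr e)"
          unfolding u_def .
      qed
      also have "\<dots> = ennreal L * (\<integral>\<^sup>+k. 
          ennreal (min (2 powr of_int k * s) (1 / (2 powr of_int k * s)) powr e) \<partial>count_space (UNIV::int set))"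
        by (rule nn_integral_cmult) auto
      also have "\<dots> \<le> ennreal L * ennreal C"
        by (intro mult_left_mono C(2) s0) auto
      also have "\<dots> = ennreal (L * C)"
        using L0 C(1) by (intro ennreal_mult[symmetric]) auto
      also have "L * C = K * A powr \<gamma> * m powr (1 - \<gamma>)"
        using c0 A0 by (simp add: L_def K_def powr_mult)
      finally show ?thesis .
    qed
    show "\<exists>V \<in> borel_measurable borel. (\<forall>x. ennreal_powr (hl_maximal g x) \<gamma> \<le> V x) \<and>
        (\<forall>E m. E \<in> sets borel \<longrightarrow> m > 0 \<longrightarrow> emeasure lborel E \<le> ennreal m \<longrightarrow>
          (\<integral>\<^sup>+x. V x * indicator E x \<partial>lborel)
            \<le> ennreal (K * (LINT x|lebesgue. \<bar>g x\<bar>) powr \<gamma> * m powr (1 - \<gamma>)))"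
      using V_meas maj bound unfolding A_def by blast
  qed
qed

section \<open>Sobolev inequality against a weak-type weight\<close>

text \<open>The fundamental theorem of calculus on [0, R], then R to infinity. It is applied to the
  gauge integral, for which \<open>u'\<close> may be any derivative; continuity is asked of the
  majorant \<open>b\<close>.\<close>

lemma abs_le_nn_integral_deriv_bound:
  fixes u u' b :: "real \<Rightarrow> real"
  assumes u: "\<And>r. r \<ge> 0 \<Longrightarrow> (u has_real_derivative u' r) (at r)"
    and le: "\<And>r. r \<ge> 0 \<Longrightarrow> \<bar>u' r\<bar> \<le> b r"
    and b: "continuous_on {0..} b"
    and lim: "(u \<longlongrightarrow> 0) at_top"
  shows "ennreal \<bar>u 0\<bar> \<le> (\<integral>\<^sup>+r. ennreal (b r) * indicator {0..} r \<partial>lborel)"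
proof (cases "\<integral>\<^sup>+r. ennreal (b r) * indicator {0..} r \<partial>lborel")
  case (real j)
  have b0: "b r \<ge> 0" if "r \<ge> 0" for r using le[OF that] by linarith
  have *: "\<bar>u R - u 0\<bar> \<le> j" if R: "R \<ge> 0" for R
  proof -
    have int: "b integrable_on {0..R}"
      by (intro integrable_continuous_interval continuous_on_subset[OF b]) auto
    have FTC: "(u' has_integral (u R - u 0)) {0..R}"
      using u R by (intro fundamental_theorem_of_calculus)
        (auto simp: has_real_derivative_iff_has_vector_derivative[symmetric] intro: has_field_derivative_at_within)
    have "\<bar>u R - u 0\<bar> = norm (integral {0..R} u')"
      using integral_unique[OF FTC] by simp
    also have "\<dots> \<le> integral {0..R} b"
      using FTC int le by (intro integral_norm_bound_integral) auto
    finally have 1: "\<bar>u R - u 0\<bar> \<le> integral {0..R} b" .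
    have "ennreal (integral {0..R} b) = (\<integral>\<^sup>+r. ennreal (indicator {0..R} r * b r) \<partial>lborel)"
      using nn_integral_has_integral_lebesgue[of "{0..R}" b "integral {0..R} b"] int b0
      by (simp add: integrable_integral nn_integral_completion)
    also have "\<dots> \<le> (\<integral>\<^sup>+r. ennreal (b r) * indicator {0..} r \<partial>lborel)"
      by (intro nn_integral_mono) (auto simp: indicator_def)
    finally have "integral {0..R} b \<le> j" using real by simp
    with 1 show ?thesis by linarith
  qed
  have "((\<lambda>R. \<bar>u R - u 0\<bar>) \<longlongrightarrow> \<bar>0 - u 0\<bar>) at_top"
    by (intro tendsto_intros lim)
  then have "\<bar>0 - u 0\<bar> \<le> j"
    by (rule tendsto_upperbound) (auto intro!: eventually_at_top_linorderI[of 0] *)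
  then show ?thesis using real by (simp add: ennreal_leI)
qed simp

text \<open>The ray from \<open>x\<close> in direction \<open>v\<close> can meet the origin only if
  \<open>v\<close> lies on the line through 0 and \<open>x\<close>, and this line is null because
  the dimension is at least 2.\<close>

lemma ennreal_abs_le_ray_integral:
  fixes G H :: "'a::euclidean_space \<Rightarrow> real"
  assumes dim: "DIM('a) \<ge> 2"
    and G: "\<And>x. x \<noteq> 0 \<Longrightarrow> (G has_derivative D x) (at x)"
    and D: "\<And>x v. x \<noteq> 0 \<Longrightarrow> \<bar>D x v\<bar> \<le> H x * norm v"
    and H: "continuous_on (- {0}) H"
    and lim: "(G \<longlongrightarrow> 0) at_infinity"
    and x: "x \<noteq> 0"
  shows "AE v in lborel. ennreal \<bar>G x\<bar> \<le> (\<integral>\<^sup>+r. ennreal (H (x + r *\<^sub>R v) * norm v) * indicator {0..} r \<partial>lborel)"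
proof -
  have "dim (span {x}) < DIM('a)"
    using dim x by (simp add: dim_insert)
  then have "negligible (span {x})" by (rule negligible_lowdim)
  then have "span {x} \<in> null_sets lborel"
    by (simp add: negligible_iff_null_sets null_sets_completion_iff closed_subspace subspace_span borel_closed)
  then show ?thesis
  proof (rule AE_I')
    show "{v \<in> space lborel. \<not> ennreal \<bar>G x\<bar> \<le> (\<integral>\<^sup>+r. ennreal (H (x + r *\<^sub>R v) * norm v) * indicator {0..} r \<partial>lborel)} \<subseteq> span {x}"
    proof (safe, rule ccontr)
      fix v
      assume v: "v \<notin> span {x}"
      assume contra: "\<not> ennreal \<bar>G x\<bar> \<le> (\<integral>\<^sup>+r. ennreal (H (x + r *\<^sub>R v) * norm v) * indicator {0..} r \<partial>lborel)"
      have v0: "v \<noteq> 0" using v span_zero by blast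
      have nz: "x + r *\<^sub>R v \<noteq> 0" for r
      proof
        assume eq: "x + r *\<^sub>R v = 0"
        then have "r \<noteq> 0" using x by auto
        have "r *\<^sub>R v = - x" using eq by (simp add: add_eq_0_iff)
        then have "(1 / r) *\<^sub>R (r *\<^sub>R v) = (1 / r) *\<^sub>R (- x)" by simp
        then have "v = (- 1 / r) *\<^sub>R x" using \<open>r \<noteq> 0\<close> by simp
        then show False using v by (metis insertI1 span_base span_scale)
      qed
      have "ennreal \<bar>G (x + 0 *\<^sub>R v)\<bar> \<le> (\<integral>\<^sup>+r. ennreal (H (x + r *\<^sub>R v) * norm v) * indicator {0..} r \<partial>lborel)"
      proof (rule abs_le_nn_integral_deriv_bound[where u = "\<lambda>r. G (x + r *\<^sub>R v)" and u' = "\<lambda>r. D (x + r *\<^sub>R v) v"])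
        fix r :: real
        have "((\<lambda>r. G (x + r *\<^sub>R v)) has_derivative (\<lambda>h. D (x + r *\<^sub>R v) (h *\<^sub>R v))) (at r)"
          by (rule has_derivative_compose[of "\<lambda>r. x + r *\<^sub>R v", OF _ G[OF nz]]) (auto intro!: derivative_eq_intros)
        moreover have "D (x + r *\<^sub>R v) (h *\<^sub>R v) = D (x + r *\<^sub>R v) v * h" for h
          using linear_scale[OF has_derivative_linear[OF G[OF nz]]] by simp
        ultimately show "((\<lambda>r. G (x + r *\<^sub>R v)) has_real_derivative D (x + r *\<^sub>R v) v) (at r)"
          by (simp add: has_field_derivative_def)
        show "\<bar>D (x + r *\<^sub>R v) v\<bar> \<le> H (x + r *\<^sub>R v) * norm v"
          by (rule D[OF nz])
      next
        show "continuous_on {0..} (\<lambda>r. H (x + r *\<^sub>R v) * norm v)"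
          by (intro continuous_intros continuous_on_compose2[OF H]) (use nz in auto)
        have "filterlim (\<lambda>r. norm v * r + (- norm x)) at_top at_top"
          using v0 by real_asymp
        then have "filterlim (\<lambda>r. norm (x + r *\<^sub>R v)) at_top at_top"
        proof (rule filterlim_at_top_mono)
          show "\<forall>\<^sub>F r in at_top. norm v * r + (- norm x) \<le> norm (x + r *\<^sub>R v)"
          proof (rule eventually_at_top_linorderI)
            fix r :: real assume "r \<ge> 0"
            then show "norm v * r + (- norm x) \<le> norm (x + r *\<^sub>R v)"
              using norm_diff_ineq[of "r *\<^sub>R v" x] by (simp add: add.commute mult.commute)
          qed
        qed
        then have "filterlim (\<lambda>r. x + r *\<^sub>R v) at_infinity at_top"
          by (rule filterlim_norm_at_top_imp_at_infinity)
        then show "((\<lambda>r. G (x + r *\<^sub>R v)) \<longlongrightarrow> 0) at_top"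
          by (rule filterlim_compose[OF lim])
      qed
      then show False using contra by simp
    qed
  qed
qed

section \<open>Substitution, tail integrals and balanced splittings\<close>

lemma nn_integral_lborel_affine:
  fixes f :: "'a::euclidean_space \<Rightarrow> ennreal"
  assumes [measurable]: "f \<in> borel_measurable borel" and c: "c \<noteq> 0"
  shows "(\<integral>\<^sup>+x. f x \<partial>lborel) = ennreal (\<bar>c\<bar> ^ DIM('a)) * (\<integral>\<^sup>+x. f (t + c *\<^sub>R x) \<partial>lborel)"
  by (subst lborel_affine[OF c, of t])
     (simp add: nn_integral_density nn_integral_distr nn_integral_cmult)

lemma nn_integral_powr_tail:
  fixes s \<rho> c :: real
  assumes "s > 1" "c + \<rho> > 0"
  shows "(\<integral>\<^sup>+r. ennreal ((c + r) powr (- s)) * indicator {\<rho>..} r \<partial>lborel)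
    = ennreal ((c + \<rho>) powr (1 - s) / (s - 1))"
proof -
  have "(\<integral>\<^sup>+r. ennreal ((c + r) powr (- s)) * indicator {\<rho>..} r \<partial>lborel)
    = ennreal (0 - (c + \<rho>) powr (1 - s) / (1 - s))"
  proof (rule nn_integral_FTC_atLeast)
    show "((\<lambda>r. (c + r) powr (1 - s) / (1 - s)) \<longlongrightarrow> 0) at_top"
      using assms by real_asymp
    fix r assume "\<rho> \<le> r"
    then show "((\<lambda>r. (c + r) powr (1 - s) / (1 - s)) has_real_derivative (c + r) powr (- s)) (at r)"
      using assms by (auto intro!: derivative_eq_intros)
  qed auto
  also have "0 - (c + \<rho>) powr (1 - s) / (1 - s) = (c + \<rho>) powr (1 - s) / (s - 1)"
    using assms by (simp add: field_simps)
  finally show ?thesis .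
qed

text \<open>Right continuity of the power. It lets an argument that divides by a possibly vanishing
  quantity work with strictly larger, hence positive, values instead.\<close>

lemma le_ennreal_powr_limit:
  fixes c m s :: real
  assumes "m \<ge> 0" "s > 0" "\<And>m'. m' > m \<Longrightarrow> e \<le> ennreal (c * m' powr s)"
  shows "e \<le> ennreal (c * m powr s)"
proof (rule tendsto_lowerbound)
  have "((\<lambda>x. x powr s) \<longlongrightarrow> m powr s) (at_right m)"
  proof (rule tendsto_powr'[OF tendsto_ident_at tendsto_const])
    have "\<forall>\<^sub>F x in at_right m. 0 \<le> x"
      using eventually_at_right_less[of m] by eventually_elim (use assms in linarith)
    then show "m \<noteq> 0 \<or> 0 < s \<and> (\<forall>\<^sub>F x in at_right m. 0 \<le> x)" using assms by blast
  qed
  then show "((\<lambda>x. ennreal (c * x powr s)) \<longlongrightarrow> ennreal (c * m powr s)) (at_right m)"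
    by (intro tendsto_ennrealI tendsto_mult_left)
  show "\<forall>\<^sub>F x in at_right m. e \<le> ennreal (c * x powr s)"
    using assms(3) by (auto simp: eventually_at_filter)
qed simp

text \<open>Replaces Hoelder's inequality below, with \<open>l\<close> chosen at the size of the \<open>L\<^sup>p\<close> average of \<open>h\<close>.\<close>

lemma le_add_powr_mult_powr:
  fixes h l p :: real
  assumes "p \<ge> 1" "l > 0" "h \<ge> 0"
  shows "h \<le> l + l powr (1 - p) * h powr p"
proof (cases "h \<le> l")
  case False
  then have h: "h > 0" using assms by linarith
  have "h = h powr (1 - p) * h powr p"
    using h by (simp flip: powr_add)
  also have "\<dots> \<le> l powr (1 - p) * h powr p"
    using assms False by (intro mult_right_mono powr_mono2') auto
  finally show ?thesis using assms by linarith
qed (use assms in \<open>simp add: add_increasing2\<close>)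

text \<open>The parameter \<open>l\<close> stays free because its two uses differ: for small
  \<open>r\<close> it is one constant, for large \<open>r\<close> it follows the L^p average over
  the ball of radius \<open>r\<close>.\<close>

lemma average_over_ball_bound:
  fixes H :: "'a::euclidean_space \<Rightarrow> real"
  assumes p: "p \<ge> 1" and l: "l > 0" and [measurable]: "H \<in> borel_measurable borel" and H0: "\<And>x. H x \<ge> 0"
  shows "(\<integral>\<^sup>+v. ennreal (H (x + r *\<^sub>R v)) * indicator (cball 0 1) v \<partial>lborel)
    \<le> ennreal (l * unit_ball_vol (real DIM('a)))
      + ennreal (l powr (1 - p)) * (\<integral>\<^sup>+v. ennreal (H (x + r *\<^sub>R v) powr p) * indicator (cball 0 1) v \<partial>lborel)"
proof -
  have [measurable]: "cball (0::'a) 1 \<in> sets borel" by simp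
  have "(\<integral>\<^sup>+v. ennreal (H (x + r *\<^sub>R v)) * indicator (cball 0 1) v \<partial>lborel)
    \<le> (\<integral>\<^sup>+v. ennreal l * indicator (cball 0 1) v
        + ennreal (l powr (1 - p)) * (ennreal (H (x + r *\<^sub>R v) powr p) * indicator (cball 0 1) v) \<partial>lborel)"
  proof (intro nn_integral_mono)
    fix v
    have "ennreal (H (x + r *\<^sub>R v)) \<le> ennreal (l + l powr (1 - p) * H (x + r *\<^sub>R v) powr p)"
      by (intro ennreal_leI le_add_powr_mult_powr p l H0)
    also have "\<dots> = ennreal l + ennreal (l powr (1 - p)) * ennreal (H (x + r *\<^sub>R v) powr p)"
      using l by (simp add: ennreal_plus ennreal_mult)
    finally show "ennreal (H (x + r *\<^sub>R v)) * indicator (cball 0 1) v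
      \<le> ennreal l * indicator (cball 0 1) v
        + ennreal (l powr (1 - p)) * (ennreal (H (x + r *\<^sub>R v) powr p) * indicator (cball 0 1) v)"
      by (simp add: indicator_def)
  qed
  also have "\<dots> = ennreal l * emeasure lborel (cball (0::'a) 1)
      + ennreal (l powr (1 - p)) * (\<integral>\<^sup>+v. ennreal (H (x + r *\<^sub>R v) powr p) * indicator (cball 0 1) v \<partial>lborel)"
    by (simp add: nn_integral_add nn_integral_cmult)
  also have "ennreal l * emeasure lborel (cball (0::'a) 1) = ennreal (l * unit_ball_vol (real DIM('a)))"
    using l by (simp add: emeasure_cball ennreal_mult)
  finally show ?thesis .
qed

text \<open>Averaging the ray integral over directions \<open>v\<close> in the unit ball and splitting at \<open>r = \<rho>\<close>: for
  \<open>r > \<rho>\<close> the integral over \<open>v\<close> is at most a multiple of \<open>r\<^sup>-\<^sup>n\<^sup>/\<^sup>p N\<^sup>1\<^sup>/\<^sup>p\<close>, which is integrable at infinity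
  because \<open>p < n\<close>; for \<open>r \<le> \<rho>\<close> one integrates over \<open>x\<close> as well and uses translation invariance.\<close>

lemma weak_type_sobolev_inequality:
  fixes p :: real
  assumes dim: "DIM('a::euclidean_space) \<ge> 2" and p: "1 < p" "p < DIM('a)"
  obtains C where "C > 0"
    "\<And>G H D N. \<lbrakk>\<And>x::'a. x \<noteq> 0 \<Longrightarrow> (G has_derivative D x) (at x);
      \<And>x v. x \<noteq> 0 \<Longrightarrow> \<bar>D x v\<bar> \<le> H x * norm v; continuous_on (- {0}) H; \<And>x. H x \<ge> 0;
      (G \<longlongrightarrow> 0) at_infinity; N > 0; (\<integral>\<^sup>+x. ennreal (H x powr p) \<partial>lborel) \<le> ennreal N\<rbrakk>
      \<Longrightarrow> emeasure lborel {x. x \<noteq> 0 \<and> 1 / 2 \<le> \<bar>G x\<bar>} \<le> ennreal (C * N powr (DIM('a) / (DIM('a) - p)))"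
proof -
  define n where "n = real DIM('a)"
  define \<beta> where "\<beta> = unit_ball_vol n"
  define s where "s = n / p"
  \<comment> \<open>Chosen so that the far part of the ray integral comes out as
    \<open>\<beta> / 8\<close>, as recorded in \<open>\<rho>_eq\<close>.\<close>
  define c where "c = 8 * (\<beta> + 1) / (\<beta> * (s - 1))"
  define C where "C = 4 * 8 powr (p - 1) * c powr (p / (s - 1))"
  have n: "p < n" "n \<ge> 2" using p dim by (auto simp: n_def)
  have \<beta>: "\<beta> > 0" unfolding \<beta>_def using n by simp
  have s: "s > 1" using n p by (simp add: s_def)
  have c: "c > 0" using \<beta> s by (simp add: c_def)
  have C0: "C > 0" using c by (simp add: C_def)
  show ?thesis
  proof (rule that[OF C0])
    fix G H :: "'a \<Rightarrow> real" and D and N :: real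
    assume G: "\<And>x::'a. x \<noteq> 0 \<Longrightarrow> (G has_derivative D x) (at x)"
      and D: "\<And>x v. x \<noteq> 0 \<Longrightarrow> \<bar>D x v\<bar> \<le> H x * norm v"
      and H: "continuous_on (- {0}) H" and H0: "\<And>x. H x \<ge> 0"
      and lim: "(G \<longlongrightarrow> 0) at_infinity" and N: "N > 0"
      and HN: "(\<integral>\<^sup>+x. ennreal (H x powr p) \<partial>lborel) \<le> ennreal N"
    have [measurable]: "cball (0::'a) 1 \<in> sets borel" by simp
    have [measurable]: "H \<in> borel_measurable borel"
      by (rule borel_measurable_continuous_countable_exceptions[OF _ H]) simp
    have "continuous_on (- {0}) G"
      using G by (auto intro!: continuous_at_imp_continuous_on has_derivative_continuous)
    then have [measurable]: "G \<in> borel_measurable borel"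
      by (rule borel_measurable_continuous_countable_exceptions[rotated]) simp
    \<comment> \<open>The level 1/2 is the value at 1 of the function s^2 / (1 + s^2), through which
      \<open>G\<close> is truncated later.\<close>
    define E where "E = {x. x \<noteq> 0 \<and> 1 / 2 \<le> \<bar>G x\<bar>}"
    have E_sets [measurable]: "E \<in> sets borel" unfolding E_def by measurable
    \<comment> \<open>Solves c N^(1/p) \<rho>^(1-s) = 1, which fixes the size of the tail integral
      beyond \<open>\<rho>\<close>.\<close>
    define \<rho> where "\<rho> = (c * N powr (1 / p)) powr (1 / (s - 1))"
    have \<rho>: "\<rho> > 0" using c N by (simp add: \<rho>_def)
    have "\<rho> powr (1 - s) = 1 / (c * N powr (1 / p))"
    proof -
      have "1 / (s - 1) * (1 - s) = -1" using s by (simp add: field_simps)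
      then have "\<rho> powr (1 - s) = (c * N powr (1 / p)) powr (- 1)"
        unfolding \<rho>_def powr_powr by simp
      also have "\<dots> = 1 / (c * N powr (1 / p))"
        using c N by (subst powr_minus_divide) simp
      finally show ?thesis .
    qed
    moreover have "(\<beta> + 1) * M * (1 / (c * M) / (s - 1)) = \<beta> / 8" if "M > 0" for M
    proof -
      have cs: "c * (s - 1) = 8 * (\<beta> + 1) / \<beta>" using s by (simp add: c_def)
      have "(\<beta> + 1) / (c * (s - 1)) = \<beta> / 8" unfolding cs using \<beta> by (simp add: divide_simps add_pos_pos)
      then show ?thesis using that by (simp add: mult.assoc)
    qed
    ultimately have \<rho>_eq: "(\<beta> + 1) * N powr (1 / p) * (\<rho> powr (1 - s) / (s - 1)) = \<beta> / 8"
      using N by simp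
    define S where "S x r = (\<integral>\<^sup>+v. ennreal (H (x + r *\<^sub>R v) powr p) * indicator (cball 0 1) v \<partial>lborel)" for x r
    define T where "T x = (\<integral>\<^sup>+r. indicator {0..\<rho>} r * S x r \<partial>lborel)" for x
    \<comment> \<open>With this value the constant term integrates over 0 \<le> r \<le> \<rho> to
      exactly \<open>\<beta> / 8\<close>.\<close>
    define l where "l = 1 / (8 * \<rho>)"
    have l: "l > 0" using \<rho> by (simp add: l_def)
    have [measurable]: "case_prod S \<in> borel_measurable (borel \<Otimes>\<^sub>M borel)"
      unfolding S_def by measurable
    have [measurable]: "T \<in> borel_measurable borel"
      unfolding T_def by measurable
    have far: "(\<integral>\<^sup>+v. ennreal (H (x + r *\<^sub>R v)) * indicator (cball 0 1) v \<partial>lborel)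
        \<le> ennreal ((\<beta> + 1) * N powr (1 / p)) * ennreal (r powr (- s))" if r: "r > 0" for x r
    proof -
      \<comment> \<open>The substitution y = x + r v bounds the integral of H^p over the directions
        by N r^(-n); \<open>L\<close> is the p-th root of this bound, the choice that turns the
        second term of the splitting into \<open>L\<close> itself.\<close>
      define L where "L = N powr (1 / p) * r powr (- s)"
      have L: "L > 0" using N r by (simp add: L_def)
      have "S x r \<le> (\<integral>\<^sup>+v. ennreal (H (x + r *\<^sub>R v) powr p) \<partial>lborel)"
        unfolding S_def by (intro nn_integral_mono) (auto simp: indicator_def)
      also have "\<dots> = ennreal (r powr (- n)) * (ennreal (r powr n) * (\<integral>\<^sup>+v. ennreal (H (x + r *\<^sub>R v) powr p) \<partial>lborel))"
        using r by (simp add: mult.assoc[symmetric] ennreal_mult[symmetric] powr_add[symmetric])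
      also have "ennreal (r powr n) * (\<integral>\<^sup>+v. ennreal (H (x + r *\<^sub>R v) powr p) \<partial>lborel)
          = (\<integral>\<^sup>+y. ennreal (H y powr p) \<partial>lborel)"
        using nn_integral_lborel_affine[of "\<lambda>y. ennreal (H y powr p)" r x] r
        by (simp add: n_def powr_realpow)
      also have "\<dots> \<le> ennreal N" by (rule HN)
      finally have S_le: "S x r \<le> ennreal (r powr (- n)) * ennreal N" by (simp add: mult_left_mono)
      have L_eq: "L powr (1 - p) * (r powr (- n) * N) = L"
      proof -
        have e1: "1 / p * (1 - p) + 1 = 1 / p" and e2: "(- s) * (1 - p) + (- n) = - s"
          using p by (simp_all add: s_def field_simps)
        have "L powr (1 - p) * (r powr (- n) * N)
          = (N powr (1 / p * (1 - p)) * N powr 1) * (r powr ((- s) * (1 - p)) * r powr (- n))"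
          using N by (simp add: L_def powr_mult powr_powr)
        also have "\<dots> = L" unfolding L_def powr_add[symmetric] e1 e2 ..
        finally show ?thesis .
      qed
      have "(\<integral>\<^sup>+v. ennreal (H (x + r *\<^sub>R v)) * indicator (cball 0 1) v \<partial>lborel)
          \<le> ennreal (L * \<beta>) + ennreal (L powr (1 - p)) * S x r"
        unfolding S_def \<beta>_def n_def using p L H0 by (intro average_over_ball_bound) auto
      also have "\<dots> \<le> ennreal (L * \<beta>) + ennreal (L powr (1 - p)) * (ennreal (r powr (- n)) * ennreal N)"
        by (intro add_left_mono mult_left_mono S_le) auto
      also have "\<dots> = ennreal (L * \<beta> + L)"
        using N L \<beta> L_eq by (simp add: ennreal_mult[symmetric] ennreal_plus[symmetric] del: ennreal_plus)
      also have "\<dots> = ennreal ((\<beta> + 1) * N powr (1 / p)) * ennreal (r powr (- s))"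
        using \<beta> by (subst ennreal_mult[symmetric]) (auto simp: L_def algebra_simps)
      finally show ?thesis .
    qed
    \<comment> \<open>On \<open>E\<close> the ray integrals, integrated over the unit ball, amount
      to at least \<open>\<beta> / 2\<close>. The constant near term and the far term absorb
      \<open>\<beta> / 8\<close> each, so \<open>\<beta> / 4\<close> is left for the term with
      \<open>T x\<close>.\<close>
    have T_ge: "ennreal (\<beta> / 4 * l powr (p - 1)) \<le> T x" if x: "x \<in> E" for x
    proof -
      have x0: "x \<noteq> 0" and xG: "1 / 2 \<le> \<bar>G x\<bar>" using x by (auto simp: E_def)
      have ray: "AE v in lborel. ennreal \<bar>G x\<bar>
          \<le> (\<integral>\<^sup>+r. ennreal (H (x + r *\<^sub>R v) * norm v) * indicator {0..} r \<partial>lborel)"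
        by (rule ennreal_abs_le_ray_integral[OF dim G D H lim x0])
      have "ennreal (\<beta> / 2) = ennreal (1 / 2) * ennreal \<beta>"
        using \<beta> by (subst ennreal_mult[symmetric]) auto
      also have "\<dots> = (\<integral>\<^sup>+v. ennreal (1 / 2) * indicator (cball (0::'a) 1) v \<partial>lborel)"
        by (subst nn_integral_cmult_indicator) (simp_all add: emeasure_cball \<beta>_def n_def)
      also have "\<dots> \<le> (\<integral>\<^sup>+v. \<integral>\<^sup>+r. indicator {0..} r * (ennreal (H (x + r *\<^sub>R v)) * indicator (cball 0 1) v) \<partial>lborel \<partial>lborel)"
      proof (rule nn_integral_mono_AE, rule AE_mp[OF ray], intro AE_I2 impI)
        fix v
        assume v: "ennreal \<bar>G x\<bar> \<le> (\<integral>\<^sup>+r. ennreal (H (x + r *\<^sub>R v) * norm v) * indicator {0..} r \<partial>lborel)"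
        show "ennreal (1 / 2) * indicator (cball 0 1) v
          \<le> (\<integral>\<^sup>+r. indicator {0..} r * (ennreal (H (x + r *\<^sub>R v)) * indicator (cball 0 1) v) \<partial>lborel)"
        proof (cases "v \<in> cball 0 1")
          case True
          have "ennreal (1 / 2) \<le> ennreal \<bar>G x\<bar>" using xG by (intro ennreal_leI)
          also note v
          also have "(\<integral>\<^sup>+r. ennreal (H (x + r *\<^sub>R v) * norm v) * indicator {0..} r \<partial>lborel)
             \<le> (\<integral>\<^sup>+r. indicator {0..} r * (ennreal (H (x + r *\<^sub>R v)) * indicator (cball 0 1) v) \<partial>lborel)"
            using True H0
            by (intro nn_integral_mono) (auto simp: indicator_def intro!: ennreal_leI mult_left_le)
          finally show ?thesis using True by simp
        qed simp
      qed
      also have "\<dots> = (\<integral>\<^sup>+r. \<integral>\<^sup>+v. indicator {0..} r * (ennreal (H (x + r *\<^sub>R v)) * indicator (cball 0 1) v) \<partial>lborel \<partial>lborel)"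
        by (rule lborel_pair.Fubini'[symmetric]) measurable
      also have "\<dots> = (\<integral>\<^sup>+r. indicator {0..} r * (\<integral>\<^sup>+v. ennreal (H (x + r *\<^sub>R v)) * indicator (cball 0 1) v \<partial>lborel) \<partial>lborel)"
        by (intro nn_integral_cong nn_integral_cmult) measurable
      also have "\<dots> \<le> (\<integral>\<^sup>+r. (ennreal (l * \<beta>) * indicator {0..\<rho>} r + ennreal (l powr (1 - p)) * (indicator {0..\<rho>} r * S x r))
          + ennreal ((\<beta> + 1) * N powr (1 / p)) * (ennreal (r powr (- s)) * indicator {\<rho>..} r) \<partial>lborel)"
      proof (intro nn_integral_mono)
        fix r :: real
        let ?I = "\<integral>\<^sup>+v. ennreal (H (x + r *\<^sub>R v)) * indicator (cball 0 1) v \<partial>lborel"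
        have near: "?I \<le> ennreal (l * \<beta>) + ennreal (l powr (1 - p)) * S x r"
          unfolding S_def \<beta>_def n_def using p l H0 by (intro average_over_ball_bound) auto
        consider "r < 0" | "0 \<le> r" "r \<le> \<rho>" | "\<rho> < r" by linarith
        then show "indicator {0..} r * ?I \<le> (ennreal (l * \<beta>) * indicator {0..\<rho>} r + ennreal (l powr (1 - p)) * (indicator {0..\<rho>} r * S x r))
          + ennreal ((\<beta> + 1) * N powr (1 / p)) * (ennreal (r powr (- s)) * indicator {\<rho>..} r)"
        proof cases
          case 2
          then show ?thesis using near by (auto intro: add_increasing2)
        next
          case 3
          then show ?thesis using far[of r x] \<rho> by auto
        qed simp
      qed
      also have "\<dots> = (ennreal (l * \<beta>) * ennreal \<rho> + ennreal (l powr (1 - p)) * T x)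
          + ennreal ((\<beta> + 1) * N powr (1 / p)) * ennreal (\<rho> powr (1 - s) / (s - 1))"
        unfolding T_def using \<rho>
        by (simp add: nn_integral_add nn_integral_cmult nn_integral_powr_tail[OF s, of 0 \<rho>, simplified])
      also have "\<dots> = (ennreal (\<beta> / 8) + ennreal (l powr (1 - p)) * T x) + ennreal (\<beta> / 8)"
        using \<rho> \<beta> l N s \<rho>_eq by (simp add: ennreal_mult[symmetric] l_def)
      also have "\<dots> = ennreal (l powr (1 - p)) * T x + (ennreal (\<beta> / 8) + ennreal (\<beta> / 8))"
        by (simp add: add_ac)
      also have "ennreal (\<beta> / 8) + ennreal (\<beta> / 8) = ennreal (\<beta> / 4)"
        using \<beta> by (subst ennreal_plus[symmetric]) auto
      finally have main: "ennreal (\<beta> / 2) \<le> ennreal (l powr (1 - p)) * T x + ennreal (\<beta> / 4)" .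
      show ?thesis
      proof (cases "T x")
        case (real t)
        have "\<beta> / 2 \<le> l powr (1 - p) * t + \<beta> / 4"
          using main real \<beta> by (simp add: ennreal_mult[symmetric] ennreal_plus[symmetric] del: ennreal_plus)
        then have "l powr (p - 1) * (\<beta> / 4) \<le> l powr (p - 1) * (l powr (1 - p) * t)"
          by (intro mult_left_mono) auto
        also have "\<dots> = t"
          using l by (simp add: mult.assoc[symmetric] powr_add[symmetric])
        finally show ?thesis using real by (simp add: mult.commute ennreal_leI)
      qed simp
    qed
    \<comment> \<open>For fixed \<open>r\<close> and \<open>v\<close> the translation by r v
      preserves the integral of H^p. Chebyshev's inequality for \<open>T\<close> then bounds the
      measure of \<open>E\<close>.\<close>
    have T_int: "(\<integral>\<^sup>+x. T x \<partial>lborel) \<le> ennreal (\<rho> * \<beta> * N)"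
    proof -
      have S_int: "(\<integral>\<^sup>+x. S x r \<partial>lborel) \<le> ennreal (\<beta> * N)" for r
      proof -
        have "(\<integral>\<^sup>+x. S x r \<partial>lborel)
          = (\<integral>\<^sup>+v. \<integral>\<^sup>+x. ennreal (H (x + r *\<^sub>R v) powr p) * indicator (cball (0::'a) 1) v \<partial>lborel \<partial>lborel)"
          unfolding S_def by (rule lborel_pair.Fubini'[symmetric]) measurable
        also have "\<dots> \<le> (\<integral>\<^sup>+v. ennreal N * indicator (cball (0::'a) 1) v \<partial>lborel)"
        proof (intro nn_integral_mono)
          fix v :: 'a
          have "(\<integral>\<^sup>+x. ennreal (H (x + r *\<^sub>R v) powr p) \<partial>lborel) \<le> ennreal N"
            using HN nn_integral_lborel_affine[of "\<lambda>y. ennreal (H y powr p)" 1 "r *\<^sub>R v"] by (simp add: add.commute)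
          then show "(\<integral>\<^sup>+x. ennreal (H (x + r *\<^sub>R v) powr p) * indicator (cball (0::'a) 1) v \<partial>lborel)
            \<le> ennreal N * indicator (cball (0::'a) 1) v"
            by (simp add: nn_integral_multc mult_right_mono)
        qed
        also have "\<dots> = ennreal (\<beta> * N)"
          using N \<beta> by (simp add: nn_integral_cmult emeasure_cball \<beta>_def n_def ennreal_mult[symmetric] mult.commute)
        finally show ?thesis .
      qed
      have "(\<integral>\<^sup>+x. T x \<partial>lborel) = (\<integral>\<^sup>+r. \<integral>\<^sup>+x. indicator {0..\<rho>} r * S x r \<partial>lborel \<partial>lborel)"
        unfolding T_def by (rule lborel_pair.Fubini'[symmetric]) measurable
      also have "\<dots> \<le> (\<integral>\<^sup>+r. ennreal (\<beta> * N) * indicator {0..\<rho>} r \<partial>lborel)"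
        using S_int by (intro nn_integral_mono) (auto simp: indicator_def)
      also have "\<dots> = ennreal (\<rho> * \<beta> * N)"
        using \<rho> N \<beta> by (simp add: nn_integral_cmult ennreal_mult[symmetric] algebra_simps)
      finally show ?thesis .
    qed
    define t where "t = \<beta> / 4 * l powr (p - 1)"
    have t: "t > 0" using \<beta> l by (simp add: t_def)
    have "ennreal t * emeasure lborel E = (\<integral>\<^sup>+x. ennreal t * indicator E x \<partial>lborel)"
      by (simp add: nn_integral_cmult)
    also have "\<dots> \<le> (\<integral>\<^sup>+x. T x \<partial>lborel)"
      using T_ge by (intro nn_integral_mono) (auto simp: indicator_def t_def)
    finally have "ennreal t * emeasure lborel E \<le> ennreal (\<rho> * \<beta> * N)"
      using T_int by (rule order_trans)
    then have "ennreal (1 / t) * (ennreal t * emeasure lborel E) \<le> ennreal (1 / t) * ennreal (\<rho> * \<beta> * N)"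
      by (intro mult_left_mono) auto
    then have "emeasure lborel E \<le> ennreal (\<rho> * \<beta> * N / t)"
      using t \<rho> \<beta> N by (simp add: mult.assoc[symmetric] ennreal_mult[symmetric])
    also have "\<rho> * \<beta> * N / t = 4 * 8 powr (p - 1) * (\<rho> powr p * N)"
      using \<beta> \<rho> by (simp add: t_def l_def powr_divide powr_mult powr_diff field_simps)
    also have "\<rho> powr p = c powr (p / (s - 1)) * N powr (1 / (s - 1))"
      using c N p by (simp add: \<rho>_def powr_powr powr_mult)
    also have "4 * 8 powr (p - 1) * (c powr (p / (s - 1)) * N powr (1 / (s - 1)) * N)
        = C * N powr (1 / (s - 1) + 1)"
      using N by (simp add: C_def powr_add)
    \<comment> \<open>This exponent is P/p, where 1/P = 1/p - 1/n.\<close>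
    also have "1 / (s - 1) + 1 = DIM('a) / (DIM('a) - p)"
      using n p by (simp add: s_def n_def field_simps)
    finally show "emeasure lborel {x. x \<noteq> 0 \<and> 1 / 2 \<le> \<bar>G x\<bar>} \<le> ennreal (C * N powr (DIM('a) / (DIM('a) - p)))"
      unfolding E_def .
  qed
qed

text \<open>The hypothesis on \<open>V\<close> says that \<open>V\<close> lies in weak \<open>L\<^sup>s\<close> with \<open>1 - 1/s = q (1/p - 1/n)\<close>. Strong type follows
  from weak type by Maz'ya's truncation: apply the weak inequality to \<open>\<phi>(G / 2\<^sup>k)\<close>; since
  \<open>|\<phi>'(s)| \<le> 2 min(|s|, 1/|s|)\<close>, the gradients of these functions, scaled by \<open>2\<^sup>k\<close>, have \<open>p\<close>-th powers
  summing to at most a multiple of \<open>H\<^sup>p\<close>.\<close>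

lemma sobolev_against_weak_weight:
  fixes p q :: real
  assumes dim: "DIM('a::euclidean_space) \<ge> 2" and p: "1 < p" "p < DIM('a)" and q: "p \<le> q"
  obtains C where "C > 0"
    "\<And>G H D N V K. \<lbrakk>\<And>x::'a. x \<noteq> 0 \<Longrightarrow> (G has_derivative D x) (at x);
      \<And>x v. x \<noteq> 0 \<Longrightarrow> \<bar>D x v\<bar> \<le> H x * norm v; continuous_on (- {0}) H; \<And>x. H x \<ge> 0;
      (G \<longlongrightarrow> 0) at_infinity; N \<ge> 0; (\<integral>\<^sup>+x. ennreal (H x powr p) \<partial>lborel) \<le> ennreal N;
      V \<in> borel_measurable borel; K \<ge> 0;
      \<And>E m. E \<in> sets borel \<Longrightarrow> m > 0 \<Longrightarrow> emeasure lborel E \<le> ennreal m \<Longrightarrow>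
        (\<integral>\<^sup>+x. V x * indicator E x \<partial>lborel) \<le> ennreal (K * m powr (q * (1 / p - 1 / DIM('a))))\<rbrakk>
      \<Longrightarrow> (\<integral>\<^sup>+x. ennreal (\<bar>G x\<bar> powr q) * V x \<partial>lborel) \<le> ennreal (C * K * N powr (q / p))"
proof -
  define n where "n = real DIM('a)"
  define \<sigma> where "\<sigma> = q * (1 / p - 1 / n)"
  \<comment> \<open>Smooth, because the weak inequality asks for a derivative at every x \<noteq> 0.
    The value 0 at 0 preserves vanishing at infinity, and \<phi> \<ge> 1/2 for |s| \<ge> 1 lets the
    level 1/2 detect |G| \<ge> 2^k.\<close>
  define \<phi> where "\<phi> s = s\<^sup>2 / (1 + s\<^sup>2)" for s :: real
  define \<phi>' where "\<phi>' s = 2 * s / (1 + s\<^sup>2)\<^sup>2" for s :: real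
  have pos: "1 + s\<^sup>2 > 0" for s :: real by (simp add: add_pos_nonneg)
  have \<phi>: "(\<phi> has_real_derivative \<phi>' s) (at s)" for s
    unfolding \<phi>_def \<phi>'_def using pos[of s]
    by (auto intro!: derivative_eq_intros simp: power2_eq_square field_simps)
  have \<phi>'_le: "\<bar>\<phi>' s\<bar> \<le> 2 * min (1 / \<bar>s\<bar>) \<bar>s\<bar>" if s: "s \<noteq> 0" for s
  proof -
    have eq: "\<bar>\<phi>' s\<bar> = 2 * \<bar>s\<bar> / (1 + s\<^sup>2)\<^sup>2"
      by (simp add: \<phi>'_def abs_mult)
    have 1: "1 \<le> (1 + s\<^sup>2)\<^sup>2" by (simp add: one_le_power)
    have "\<bar>s\<bar> * \<bar>s\<bar> \<le> 1 + s\<^sup>2" by (simp add: power2_eq_square)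
    also have "\<dots> \<le> (1 + s\<^sup>2)\<^sup>2" by (rule self_le_power) auto
    finally have 2: "\<bar>s\<bar> * \<bar>s\<bar> \<le> (1 + s\<^sup>2)\<^sup>2" .
    have "\<bar>\<phi>' s\<bar> \<le> 2 * \<bar>s\<bar>"
      unfolding eq using 1 mult_left_mono[OF 1, of "2 * \<bar>s\<bar>"] by (simp add: divide_le_eq)
    moreover have "\<bar>\<phi>' s\<bar> \<le> 2 * (1 / \<bar>s\<bar>)"
      unfolding eq using 1 2 s by (simp add: divide_simps)
    ultimately show ?thesis by simp
  qed
  obtain C1 where C1: "C1 > 0"
    "\<And>G H D N. \<lbrakk>\<And>x::'a. x \<noteq> 0 \<Longrightarrow> (G has_derivative D x) (at x);
      \<And>x v. x \<noteq> 0 \<Longrightarrow> \<bar>D x v\<bar> \<le> H x * norm v; continuous_on (- {0}) H; \<And>x. H x \<ge> 0;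
      (G \<longlongrightarrow> 0) at_infinity; N > 0; (\<integral>\<^sup>+x. ennreal (H x powr p) \<partial>lborel) \<le> ennreal N\<rbrakk>
      \<Longrightarrow> emeasure lborel {x. x \<noteq> 0 \<and> 1 / 2 \<le> \<bar>G x\<bar>} \<le> ennreal (C1 * N powr (DIM('a) / (DIM('a) - p)))"
    using weak_type_sobolev_inequality[OF dim p] by blast
  have p0: "p > 0" using p by simp
  obtain C2 where C2: "C2 > 0" "\<And>s. s > 0 \<Longrightarrow>
    (\<integral>\<^sup>+k. ennreal (min (2 powr of_int k * s) (1 / (2 powr of_int k * s)) powr p)
       \<partial>count_space (UNIV::int set)) \<le> ennreal C2"
    using int_geometric_bound[OF p0] by blast
  define C3 where "C3 = 2 powr p * C2"
  have C3: "C3 > 0" using C2 by (simp add: C3_def)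
  define C where "C = 2 powr q * C1 powr \<sigma> * C3 powr (q / p)"
  have C: "C > 0" using C1(1) C3 by (simp add: C_def)
  have sum_\<phi>': "(\<integral>\<^sup>+k. ennreal (\<bar>\<phi>' (a / 2 powr of_int k)\<bar> powr p) \<partial>count_space (UNIV::int set)) \<le> ennreal C3" for a
  proof (cases "a = 0")
    case False
    \<comment> \<open>With this \<open>s\<close>, the two bounds for \<phi>' at a / 2^k become the
      two entries of the minimum in the dyadic sum.\<close>
    define s where "s = 1 / \<bar>a\<bar>"
    have s: "s > 0" using False by (simp add: s_def)
    have "(\<integral>\<^sup>+k. ennreal (\<bar>\<phi>' (a / 2 powr of_int k)\<bar> powr p) \<partial>count_space (UNIV::int set))
      \<le> (\<integral>\<^sup>+k. ennreal (2 powr p) * ennreal (min (2 powr of_int k * s) (1 / (2 powr of_int k * s)) powr p)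
        \<partial>count_space (UNIV::int set))"
    proof (intro nn_integral_mono)
      fix k :: int
      have "\<bar>\<phi>' (a / 2 powr of_int k)\<bar> \<le> 2 * min (2 powr of_int k * s) (1 / (2 powr of_int k * s))"
        using \<phi>'_le[of "a / 2 powr of_int k"] False by (simp add: s_def)
      then have "\<bar>\<phi>' (a / 2 powr of_int k)\<bar> powr p \<le> (2 * min (2 powr of_int k * s) (1 / (2 powr of_int k * s))) powr p"
        using p by (intro powr_mono2) auto
      also have "\<dots> = 2 powr p * min (2 powr of_int k * s) (1 / (2 powr of_int k * s)) powr p"
        using s by (subst powr_mult) auto
      finally show "ennreal (\<bar>\<phi>' (a / 2 powr of_int k)\<bar> powr p)
        \<le> ennreal (2 powr p) * ennreal (min (2 powr of_int k * s) (1 / (2 powr of_int k * s)) powr p)"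
        by (subst ennreal_mult[symmetric]) (auto intro: ennreal_leI)
    qed
    also have "\<dots> = ennreal (2 powr p) * (\<integral>\<^sup>+k. ennreal (min (2 powr of_int k * s) (1 / (2 powr of_int k * s)) powr p)
        \<partial>count_space (UNIV::int set))"
      by (rule nn_integral_cmult) auto
    also have "\<dots> \<le> ennreal (2 powr p) * ennreal C2"
      by (intro mult_left_mono C2(2) s) auto
    also have "\<dots> = ennreal C3"
      using C2 by (simp add: C3_def ennreal_mult)
    finally show ?thesis .
  qed (simp add: \<phi>'_def)
  show ?thesis
  proof (rule that[OF C])
    fix G H :: "'a \<Rightarrow> real" and D and N K :: real and V :: "'a \<Rightarrow> ennreal"
    assume G: "\<And>x::'a. x \<noteq> 0 \<Longrightarrow> (G has_derivative D x) (at x)"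
      and D: "\<And>x v. x \<noteq> 0 \<Longrightarrow> \<bar>D x v\<bar> \<le> H x * norm v"
      and H: "continuous_on (- {0}) H" and H0: "\<And>x. H x \<ge> 0"
      and lim: "(G \<longlongrightarrow> 0) at_infinity" and N: "N \<ge> 0"
      and HN: "(\<integral>\<^sup>+x. ennreal (H x powr p) \<partial>lborel) \<le> ennreal N"
      and V[measurable]: "V \<in> borel_measurable borel" and K: "K \<ge> 0"
      and V_le: "\<And>E m. E \<in> sets borel \<Longrightarrow> m > 0 \<Longrightarrow> emeasure lborel E \<le> ennreal m \<Longrightarrow>
        (\<integral>\<^sup>+x. V x * indicator E x \<partial>lborel) \<le> ennreal (K * m powr (q * (1 / p - 1 / DIM('a))))"
    have [measurable]: "H \<in> borel_measurable borel"
      by (rule borel_measurable_continuous_countable_exceptions[OF _ H]) simp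
    have G_cont: "continuous_on (- {0}) G"
      using G by (auto intro!: continuous_at_imp_continuous_on has_derivative_continuous)
    then have [measurable]: "G \<in> borel_measurable borel"
      by (rule borel_measurable_continuous_countable_exceptions[rotated]) simp
    have [measurable]: "\<phi>' \<in> borel_measurable borel"
      unfolding \<phi>'_def by measurable
    \<comment> \<open>2^(-p k) \<open>M k\<close> is the integral of the p-th power of the gradient
      majorant of \<phi>(G / 2^k), so \<open>M k\<close> is the share of the integral of H^p seen at
      height 2^k.\<close>
    define M where "M k = (\<integral>\<^sup>+x. ennreal (\<bar>\<phi>' (G x / 2 powr of_int k)\<bar> powr p * H x powr p) \<partial>lborel)" for k :: int
    have M_sum: "(\<integral>\<^sup>+k. M k \<partial>count_space UNIV) \<le> ennreal (C3 * N)"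
    proof -
      have "(\<integral>\<^sup>+k. M k \<partial>count_space UNIV) =
        (\<integral>\<^sup>+x. \<integral>\<^sup>+k. ennreal (\<bar>\<phi>' (G x / 2 powr of_int k)\<bar> powr p * H x powr p) \<partial>count_space (UNIV::int set) \<partial>lborel)"
        unfolding M_def by (rule nn_integral_count_space_nn_integral[symmetric]) auto
      also have "\<dots> \<le> (\<integral>\<^sup>+x. ennreal C3 * ennreal (H x powr p) \<partial>lborel)"
      proof (intro nn_integral_mono)
        fix x
        have "(\<integral>\<^sup>+k. ennreal (\<bar>\<phi>' (G x / 2 powr of_int k)\<bar> powr p * H x powr p) \<partial>count_space (UNIV::int set))
          = (\<integral>\<^sup>+k. ennreal (\<bar>\<phi>' (G x / 2 powr of_int k)\<bar> powr p) \<partial>count_space (UNIV::int set)) * ennreal (H x powr p)"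
          by (subst nn_integral_multc[symmetric]) (auto simp: ennreal_mult)
        also have "\<dots> \<le> ennreal C3 * ennreal (H x powr p)"
          by (intro mult_right_mono sum_\<phi>') auto
        finally show "(\<integral>\<^sup>+k. ennreal (\<bar>\<phi>' (G x / 2 powr of_int k)\<bar> powr p * H x powr p) \<partial>count_space (UNIV::int set))
          \<le> ennreal C3 * ennreal (H x powr p)" .
      qed
      also have "\<dots> = ennreal C3 * (\<integral>\<^sup>+x. ennreal (H x powr p) \<partial>lborel)"
        by (rule nn_integral_cmult) measurable
      also have "\<dots> \<le> ennreal C3 * ennreal N"
        by (intro mult_left_mono HN) auto
      also have "\<dots> = ennreal (C3 * N)"
        using C3 N by (simp add: ennreal_mult)
      finally show ?thesis .
    qed
    define m where "m k = enn2real (M k)" for k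
    have M_le: "M k \<le> ennreal (C3 * N)" for k
      using nn_integral_ge_point[of k UNIV M] M_sum by (meson UNIV_I order_trans)
    have M_eq: "M k = ennreal (m k)" for k
    proof -
      have "M k < top" using M_le[of k] by (rule order.strict_trans1) simp
      then show ?thesis by (simp add: m_def)
    qed
    have m0: "m k \<ge> 0" for k by (simp add: m_def)
    have m_le: "m k \<le> C3 * N" for k
      using M_le[of k] C3 N by (simp add: M_eq)
    define E where "E k = {x. x \<noteq> 0 \<and> 2 powr of_int k \<le> \<bar>G x\<bar>}" for k :: int
    have [measurable]: "E k \<in> sets borel" for k unfolding E_def by measurable
    have level: "(\<integral>\<^sup>+x. V x * indicator (E k) x \<partial>lborel)
      \<le> ennreal (K * C1 powr \<sigma> * 2 powr (- q * of_int k) * m k powr (q / p))" for k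
    \<comment> \<open>\<open>m k\<close> may be 0, whereas the weak inequality asks for a positive
      bound.\<close>
    proof (rule le_ennreal_powr_limit[OF m0])
      show "q / p > 0" using p q by simp
      fix m' assume m': "m' > m k"
      then have m'0: "m' > 0" using m0[of k] by linarith
      define t where "t = 2 powr real_of_int k"
      have t: "t > 0" by (simp add: t_def)
      define N' where "N' = t powr (- p) * m'"
      have N': "N' > 0" using t m'0 by (simp add: N'_def)
      have "emeasure lborel {x. x \<noteq> 0 \<and> 1 / 2 \<le> \<bar>\<phi> (G x / t)\<bar>}
        \<le> ennreal (C1 * N' powr (DIM('a) / (DIM('a) - p)))"
      proof (rule C1(2)[where D = "\<lambda>x v. \<phi>' (G x / t) * (D x v / t)" and H = "\<lambda>x. \<bar>\<phi>' (G x / t)\<bar> / t * H x"])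
        fix x :: 'a assume x: "x \<noteq> 0"
        have "((\<lambda>x. G x / t) has_derivative (\<lambda>v. D x v / t)) (at x)"
          by (rule bounded_linear.has_derivative[OF bounded_linear_divide G[OF x]])
        moreover have "(\<phi> has_derivative (*) (\<phi>' (G x / t))) (at (G x / t))"
          using \<phi> by (simp add: has_field_derivative_def)
        ultimately show "((\<lambda>x. \<phi> (G x / t)) has_derivative (\<lambda>v. \<phi>' (G x / t) * (D x v / t))) (at x)"
          by (rule has_derivative_compose)
        fix v
        have "\<bar>\<phi>' (G x / t) * (D x v / t)\<bar> = \<bar>\<phi>' (G x / t)\<bar> / t * \<bar>D x v\<bar>"
          using t by (simp add: abs_mult)
        also have "\<dots> \<le> \<bar>\<phi>' (G x / t)\<bar> / t * (H x * norm v)"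
          using t by (intro mult_left_mono D x) auto
        finally show "\<bar>\<phi>' (G x / t) * (D x v / t)\<bar> \<le> \<bar>\<phi>' (G x / t)\<bar> / t * H x * norm v" by simp
      next
        show "continuous_on (- {0}) (\<lambda>x. \<bar>\<phi>' (G x / t)\<bar> / t * H x)"
          unfolding \<phi>'_def using t pos
          by (intro continuous_intros G_cont H) (auto simp: less_imp_neq[THEN not_sym])
        have "((\<lambda>x. \<phi> (G x / t)) \<longlongrightarrow> (0 / t)\<^sup>2 / (1 + (0 / t)\<^sup>2)) at_infinity"
          unfolding \<phi>_def using t by (intro tendsto_intros lim) auto
        then show "((\<lambda>x. \<phi> (G x / t)) \<longlongrightarrow> 0) at_infinity" by simp
        have "(\<integral>\<^sup>+x. ennreal ((\<bar>\<phi>' (G x / t)\<bar> / t * H x) powr p) \<partial>lborel)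
          = (\<integral>\<^sup>+x. ennreal (t powr (- p)) * ennreal (\<bar>\<phi>' (G x / t)\<bar> powr p * H x powr p) \<partial>lborel)"
          using t H0 by (intro nn_integral_cong)
            (simp add: powr_mult powr_divide powr_minus_divide ennreal_mult[symmetric])
        also have "\<dots> = ennreal (t powr (- p)) * M k"
          unfolding M_def t_def by (rule nn_integral_cmult) measurable
        also have "\<dots> \<le> ennreal (t powr (- p)) * ennreal m'"
          using m' by (intro mult_left_mono) (auto simp: M_eq intro: ennreal_leI)
        also have "\<dots> = ennreal N'"
          using m'0 by (simp add: N'_def ennreal_mult)
        finally show "(\<integral>\<^sup>+x. ennreal ((\<bar>\<phi>' (G x / t)\<bar> / t * H x) powr p) \<partial>lborel) \<le> ennreal N'" .
      qed (use t H0 N' in auto)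
      moreover have "E k \<subseteq> {x. x \<noteq> 0 \<and> 1 / 2 \<le> \<bar>\<phi> (G x / t)\<bar>}"
      proof
        fix x assume "x \<in> E k"
        then have x: "x \<noteq> 0" "1 \<le> \<bar>G x / t\<bar>" using t by (auto simp: E_def t_def)
        have "1 \<le> (G x / t)\<^sup>2"
          using x(2) abs_le_square_iff[of 1 "G x / t"] by simp
        then have "1 / 2 \<le> \<phi> (G x / t)"
          unfolding \<phi>_def using pos[of "G x / t"] by (subst pos_le_divide_eq) auto
        then show "x \<in> {x. x \<noteq> 0 \<and> 1 / 2 \<le> \<bar>\<phi> (G x / t)\<bar>}" using x by auto
      qed
      moreover have "{x. x \<noteq> 0 \<and> 1 / 2 \<le> \<bar>\<phi> (G x / t)\<bar>} \<in> sets borel"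
        unfolding \<phi>_def by measurable
      ultimately have "emeasure lborel (E k) \<le> ennreal (C1 * N' powr (DIM('a) / (DIM('a) - p)))"
        by - (rule order_trans[OF emeasure_mono], simp_all only: sets_lborel)
      then have "(\<integral>\<^sup>+x. V x * indicator (E k) x \<partial>lborel)
        \<le> ennreal (K * (C1 * N' powr (DIM('a) / (DIM('a) - p))) powr \<sigma>)"
        unfolding \<sigma>_def n_def using C1(1) N' by (intro V_le) auto
      also have "(C1 * N' powr (DIM('a) / (DIM('a) - p))) powr \<sigma> = C1 powr \<sigma> * N' powr (q / p)"
      proof -
        \<comment> \<open>With 1/P = 1/p - 1/n this is the product of P/p and q/P.\<close>
        have "DIM('a) / (DIM('a) - p) * \<sigma> = q / p"
          using p by (simp add: \<sigma>_def n_def field_simps)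
        then show ?thesis using C1(1) N' by (simp add: powr_mult powr_powr)
      qed
      also have "N' powr (q / p) = 2 powr (- q * of_int k) * m' powr (q / p)"
        using m'0 p by (simp add: N'_def t_def powr_mult powr_powr mult.commute)
      finally show "(\<integral>\<^sup>+x. V x * indicator (E k) x \<partial>lborel)
        \<le> ennreal (K * C1 powr \<sigma> * 2 powr (- q * of_int k) * m' powr (q / p))"
        by (simp add: mult.assoc)
    qed
    \<comment> \<open>Here p \<le> q enters: m_k^(q/p) \<le> (sup m)^(q/p - 1) m_k, with sup m at
      most C3 N. What remains is the sum of the m_k themselves.\<close>
    define B where "B = 2 powr q * K * C1 powr \<sigma> * (C3 * N) powr (q / p - 1)"
    have B: "B \<ge> 0" using K by (simp add: B_def)
    have "(\<integral>\<^sup>+x. ennreal (\<bar>G x\<bar> powr q) * V x \<partial>lborel)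
      \<le> (\<integral>\<^sup>+x. \<integral>\<^sup>+k. ennreal (2 powr (q * (of_int k + 1))) * (V x * indicator (E k) x) \<partial>count_space (UNIV::int set) \<partial>lborel)"
    proof (rule nn_integral_mono_AE, rule AE_I')
      show "{0} \<in> null_sets lborel" by (intro null_setsI) auto
      show "{x \<in> space lborel. \<not> ennreal (\<bar>G x\<bar> powr q) * V x
        \<le> (\<integral>\<^sup>+k. ennreal (2 powr (q * (of_int k + 1))) * (V x * indicator (E k) x) \<partial>count_space (UNIV::int set))} \<subseteq> {0}"
      proof (safe, rule ccontr)
        fix x :: 'a assume x: "x \<noteq> 0"
        assume contra: "\<not> ennreal (\<bar>G x\<bar> powr q) * V x
          \<le> (\<integral>\<^sup>+k. ennreal (2 powr (q * (of_int k + 1))) * (V x * indicator (E k) x) \<partial>count_space (UNIV::int set))"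
        have Gx: "\<bar>G x\<bar> > 0" using contra by (cases "G x = 0") auto
        define k where "k = \<lfloor>log 2 \<bar>G x\<bar>\<rfloor>"
        have "of_int k \<le> log 2 \<bar>G x\<bar>" "log 2 \<bar>G x\<bar> \<le> of_int k + 1" unfolding k_def by linarith+
        then have k: "2 powr of_int k \<le> \<bar>G x\<bar>" "\<bar>G x\<bar> \<le> 2 powr (of_int k + 1)"
          using Gx by (simp_all add: le_log_iff log_le_iff)
        have "\<bar>G x\<bar> powr q \<le> (2 powr (of_int k + 1)) powr q"
          using k p q by (intro powr_mono2) auto
        then have "ennreal (\<bar>G x\<bar> powr q) \<le> ennreal (2 powr (q * (of_int k + 1)))"
          by (intro ennreal_leI) (simp add: powr_powr mult.commute)
        then have "ennreal (\<bar>G x\<bar> powr q) * V x \<le> ennreal (2 powr (q * (of_int k + 1))) * (V x * indicator (E k) x)"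
          using x k by (simp add: E_def mult_right_mono)
        also have "\<dots> \<le> (\<integral>\<^sup>+k. ennreal (2 powr (q * (of_int k + 1))) * (V x * indicator (E k) x) \<partial>count_space (UNIV::int set))"
          by (rule nn_integral_ge_point) simp
        finally show False using contra by simp
      qed
    qed
    also have "\<dots> = (\<integral>\<^sup>+k. \<integral>\<^sup>+x. ennreal (2 powr (q * (of_int k + 1))) * (V x * indicator (E k) x) \<partial>lborel \<partial>count_space (UNIV::int set))"
      by (intro nn_integral_count_space_nn_integral) auto
    also have "\<dots> \<le> (\<integral>\<^sup>+k. ennreal B * M k \<partial>count_space (UNIV::int set))"
    proof (intro nn_integral_mono)
      fix k :: int
      have "(\<integral>\<^sup>+x. ennreal (2 powr (q * (of_int k + 1))) * (V x * indicator (E k) x) \<partial>lborel)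
        = ennreal (2 powr (q * (of_int k + 1))) * (\<integral>\<^sup>+x. V x * indicator (E k) x \<partial>lborel)"
        by (rule nn_integral_cmult) measurable
      also have "\<dots> \<le> ennreal (2 powr (q * (of_int k + 1)))
          * ennreal (K * C1 powr \<sigma> * 2 powr (- q * of_int k) * m k powr (q / p))"
        by (intro mult_left_mono level) auto
      also have "\<dots> = ennreal (2 powr (q * (of_int k + 1)) * (K * C1 powr \<sigma> * 2 powr (- q * of_int k) * m k powr (q / p)))"
        using K by (intro ennreal_mult[symmetric]) auto
      also have "\<dots> = ennreal (2 powr q * K * C1 powr \<sigma> * m k powr (q / p))"
        by (simp add: distrib_left powr_add powr_minus field_simps)
      also have "\<dots> \<le> ennreal (B * m k)"
      proof (intro ennreal_leI)
        have "m k powr (q / p) = m k powr (q / p - 1) * m k"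
        proof (cases "m k = 0")
          case False
          then have "m k > 0" using m0[of k] by linarith
          then show ?thesis by (simp add: powr_diff)
        qed simp
        also have "\<dots> \<le> (C3 * N) powr (q / p - 1) * m k"
          using m0 m_le p q by (intro mult_right_mono powr_mono2) auto
        finally have "2 powr q * K * C1 powr \<sigma> * m k powr (q / p)
          \<le> 2 powr q * K * C1 powr \<sigma> * ((C3 * N) powr (q / p - 1) * m k)"
          using K by (intro mult_left_mono) auto
        then show "2 powr q * K * C1 powr \<sigma> * m k powr (q / p) \<le> B * m k"
          by (simp add: B_def mult.assoc)
      qed
      also have "\<dots> = ennreal B * M k"
        using B m0 by (simp add: M_eq ennreal_mult)
      finally show "(\<integral>\<^sup>+x. ennreal (2 powr (q * (of_int k + 1))) * (V x * indicator (E k) x) \<partial>lborel) \<le> ennreal B * M k" .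
    qed
    also have "\<dots> = ennreal B * (\<integral>\<^sup>+k. M k \<partial>count_space UNIV)"
      by (rule nn_integral_cmult) auto
    also have "\<dots> \<le> ennreal B * ennreal (C3 * N)"
      by (intro mult_left_mono M_sum) auto
    also have "\<dots> = ennreal (B * (C3 * N))"
      using B C3 N by (simp add: ennreal_mult)
    also have "B * (C3 * N) = C * K * N powr (q / p)"
    proof (cases "N = 0")
      case False
      then have "C3 * N > 0" using C3 N by simp
      then have "(C3 * N) powr (q / p - 1) * (C3 * N) = (C3 * N) powr (q / p)"
        by (simp add: powr_diff)
      then have "B * (C3 * N) = 2 powr q * K * C1 powr \<sigma> * (C3 * N) powr (q / p)"
        by (simp add: B_def mult.assoc)
      then show ?thesis using C3 N by (simp add: C_def powr_mult)
    qed simp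
    finally show "(\<integral>\<^sup>+x. ennreal (\<bar>G x\<bar> powr q) * V x \<partial>lborel) \<le> ennreal (C * K * N powr (q / p))" .
  qed
qed

section \<open>Hardy's inequality and power weights\<close>

text \<open>A Schur-type argument along the ray away from the origin: |f(x)| is at most |x| times
  the integral of h((1+r) x) over r \<ge> 0. The integrand is split by
  \<open>le_add_powr_mult_powr\<close> with the weight (1+r)^(-\<kappa>), and the dilation y = (1+r)
  x reduces the p-th power estimate to the integral of (1+r)^(-e). Both \<open>\<kappa>\<close> and
  \<open>e\<close> have to exceed 1.\<close>

lemma weighted_hardy_inequality:
  fixes p a :: real
  assumes p: "1 < p" "p < DIM('a::euclidean_space)" and a: "a \<ge> 0"
  obtains C where "C > 0"
    "\<And>f D h N. \<lbrakk>\<And>x::'a. (f has_derivative D x) (at x);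
      \<And>x v. \<bar>D x v\<bar> \<le> h x * norm v; continuous_on UNIV h; \<And>x. h x \<ge> 0;
      (f \<longlongrightarrow> 0) at_infinity; N \<ge> 0;
      (\<integral>\<^sup>+x. ennreal ((norm x powr a * h x) powr p) \<partial>lborel) \<le> ennreal N\<rbrakk>
      \<Longrightarrow> (\<integral>\<^sup>+x. ennreal ((norm x powr (a - 1) * \<bar>f x\<bar>) powr p) \<partial>lborel) \<le> ennreal (C * N)"
proof -
  define n where "n = real DIM('a)"
  \<comment> \<open>\<kappa> > 1 means \<kappa> (p-1) > p-1, and e > 1 in the case a = 0 means
    \<kappa> (p-1) < n-1. This \<open>\<kappa>\<close> puts \<kappa> (p-1) at the midpoint of that
    interval, which is nonempty since p < n.\<close>
  define \<kappa> where "\<kappa> = (n + p - 2) / (2 * (p - 1))"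
  have n: "p < n" using p by (simp add: n_def)
  have \<kappa>: "\<kappa> > 1" using n p by (simp add: \<kappa>_def field_simps)
  have \<kappa>p: "\<kappa> * (p - 1) = (n + p - 2) / 2" using p by (simp add: \<kappa>_def field_simps)
  define e where "e = a * p + n - \<kappa> * (p - 1)"
  have "a * p \<ge> 0" using a p by simp
  moreover have "(n + p - 2) / 2 < n - 1" using n by (simp add: field_simps)
  ultimately have e: "e > 1" unfolding e_def \<kappa>p by linarith
  \<comment> \<open>1/(\<kappa>-1) is the integral of (1+r)^(-\<kappa>) over r \<ge> 0; the summand
    1 comes from the p-th power term of the splitting.\<close>
  define c where "c = 1 / (\<kappa> - 1) + 1"
  have c: "c > 0" using \<kappa> by (simp add: c_def add_pos_pos)
  define C where "C = c powr p / (e - 1)"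
  have C: "C > 0" using c e by (simp add: C_def)
  show ?thesis
  proof (rule that[OF C])
    fix f h :: "'a \<Rightarrow> real" and D and N :: real
    assume f: "\<And>x::'a. (f has_derivative D x) (at x)"
      and D: "\<And>x v. \<bar>D x v\<bar> \<le> h x * norm v"
      and h: "continuous_on UNIV h" and h0: "\<And>x. h x \<ge> 0"
      and lim: "(f \<longlongrightarrow> 0) at_infinity" and N: "N \<ge> 0"
      and hN: "(\<integral>\<^sup>+x. ennreal ((norm x powr a * h x) powr p) \<partial>lborel) \<le> ennreal N"
    have [measurable]: "h \<in> borel_measurable borel"
      using h by (rule borel_measurable_continuous_onI)
    have "continuous_on UNIV f"
      using f by (auto intro!: continuous_at_imp_continuous_on has_derivative_continuous)
    then have [measurable]: "f \<in> borel_measurable borel" by (rule borel_measurable_continuous_onI)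
    define X where "X x = (\<integral>\<^sup>+r. ennreal ((1 + r) powr (\<kappa> * (p - 1)) * h (x + r *\<^sub>R x) powr p) * indicator {0..} r \<partial>lborel)" for x
    have pointwise: "ennreal (\<bar>f x\<bar> powr p) \<le> ennreal (c powr p * norm x powr p) * X x" if x: "x \<noteq> 0" for x
    proof (cases "X x")
      case top
      then show ?thesis using x c by (simp add: ennreal_mult_top)
    next
      case (real y)
      have "ennreal (\<bar>f x\<bar> powr p) \<le> ennreal (c powr p * norm x powr p * y powr 1)"
      proof (rule le_ennreal_powr_limit)
        fix Y assume Y: "Y > y"
        then have Y0: "Y > 0" using real by linarith
        \<comment> \<open>This choice turns \<mu>^(1-p) Y into \<mu>, so both terms of the splitting
          are multiples of |x| \<mu>. Working with Y > y ensures \<mu> > 0.\<close>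
        define \<mu> where "\<mu> = Y powr (1 / p)"
        have \<mu>: "\<mu> > 0" using Y0 by (simp add: \<mu>_def)
        have \<mu>Y: "\<mu> powr (1 - p) * Y = \<mu>"
        proof -
          have "1 / p * (1 - p) + 1 = 1 / p" using p by (simp add: field_simps)
          then have "Y powr (1 / p * (1 - p)) * Y powr 1 = Y powr (1 / p)"
            unfolding powr_add[symmetric] by simp
          then show ?thesis using Y0 by (simp add: \<mu>_def powr_powr)
        qed
        have "filterlim (\<lambda>r. norm x * r) at_top at_top"
          using x by real_asymp
        moreover have "\<forall>\<^sub>F r in at_top. norm x * r \<le> norm (x + r *\<^sub>R x)"
        proof (rule eventually_at_top_linorderI)
          fix r :: real assume r: "r \<ge> 0"
          have "norm (x + r *\<^sub>R x) = (1 + r) * norm x"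
            using r by (metis abs_of_nonneg add_nonneg_nonneg norm_scaleR scaleR_add_left scaleR_one zero_le_one)
          then show "norm x * r \<le> norm (x + r *\<^sub>R x)" by (simp add: algebra_simps)
        qed
        ultimately have "filterlim (\<lambda>r. norm (x + r *\<^sub>R x)) at_top at_top"
          by (rule filterlim_at_top_mono)
        then have ray_inf: "filterlim (\<lambda>r. x + r *\<^sub>R x) at_infinity at_top"
          by (rule filterlim_norm_at_top_imp_at_infinity)
        have "ennreal \<bar>f (x + 0 *\<^sub>R x)\<bar> \<le> (\<integral>\<^sup>+r. ennreal (h (x + r *\<^sub>R x) * norm x) * indicator {0..} r \<partial>lborel)"
        proof (rule abs_le_nn_integral_deriv_bound[where u = "\<lambda>r. f (x + r *\<^sub>R x)" and u' = "\<lambda>r. D (x + r *\<^sub>R x) x"])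
          fix r :: real
          have "((\<lambda>r. f (x + r *\<^sub>R x)) has_derivative (\<lambda>t. D (x + r *\<^sub>R x) (t *\<^sub>R x))) (at r)"
            by (rule has_derivative_compose[of "\<lambda>r. x + r *\<^sub>R x", OF _ f]) (auto intro!: derivative_eq_intros)
          moreover have "D (x + r *\<^sub>R x) (t *\<^sub>R x) = D (x + r *\<^sub>R x) x * t" for t
            using linear_scale[OF has_derivative_linear[OF f]] by simp
          ultimately show "((\<lambda>r. f (x + r *\<^sub>R x)) has_real_derivative D (x + r *\<^sub>R x) x) (at r)"
            by (simp add: has_field_derivative_def)
          show "\<bar>D (x + r *\<^sub>R x) x\<bar> \<le> h (x + r *\<^sub>R x) * norm x" by (rule D)
        next
          show "continuous_on {0..} (\<lambda>r. h (x + r *\<^sub>R x) * norm x)"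
            by (intro continuous_intros continuous_on_compose2[OF h]) auto
          show "((\<lambda>r. f (x + r *\<^sub>R x)) \<longlongrightarrow> 0) at_top"
            by (rule filterlim_compose[OF lim ray_inf])
        qed
        also have "\<dots> \<le> (\<integral>\<^sup>+r. ennreal (\<mu> * norm x) * (ennreal ((1 + r) powr (- \<kappa>)) * indicator {0..} r)
            + ennreal (\<mu> powr (1 - p) * norm x) * (ennreal ((1 + r) powr (\<kappa> * (p - 1)) * h (x + r *\<^sub>R x) powr p) * indicator {0..} r) \<partial>lborel)"
        proof (intro nn_integral_mono)
          fix r :: real
          show "ennreal (h (x + r *\<^sub>R x) * norm x) * indicator {0..} r
            \<le> ennreal (\<mu> * norm x) * (ennreal ((1 + r) powr (- \<kappa>)) * indicator {0..} r)
            + ennreal (\<mu> powr (1 - p) * norm x) * (ennreal ((1 + r) powr (\<kappa> * (p - 1)) * h (x + r *\<^sub>R x) powr p) * indicator {0..} r)"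
          proof (cases "r \<ge> 0")
            case True
            define l where "l = \<mu> * (1 + r) powr (- \<kappa>)"
            have l: "l > 0" using \<mu> True by (simp add: l_def)
            have "l powr (1 - p) = \<mu> powr (1 - p) * (1 + r) powr (\<kappa> * (p - 1))"
            proof -
              have "- \<kappa> * (1 - p) = \<kappa> * (p - 1)" by (simp add: algebra_simps)
              then show ?thesis
                using \<mu> True unfolding l_def by (subst powr_mult) (auto simp: powr_powr)
            qed
            then have "h (x + r *\<^sub>R x) \<le> \<mu> * (1 + r) powr (- \<kappa>) + \<mu> powr (1 - p) * (1 + r) powr (\<kappa> * (p - 1)) * h (x + r *\<^sub>R x) powr p"
              using le_add_powr_mult_powr[of p l "h (x + r *\<^sub>R x)"] p l h0 by (simp add: l_def)
            then have "h (x + r *\<^sub>R x) * norm x \<le> (\<mu> * (1 + r) powr (- \<kappa>) + \<mu> powr (1 - p) * (1 + r) powr (\<kappa> * (p - 1)) * h (x + r *\<^sub>R x) powr p) * norm x"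
              by (intro mult_right_mono) auto
            also have "\<dots> = \<mu> * norm x * (1 + r) powr (- \<kappa>)
              + \<mu> powr (1 - p) * norm x * ((1 + r) powr (\<kappa> * (p - 1)) * h (x + r *\<^sub>R x) powr p)"
              by (simp add: algebra_simps)
            finally have "ennreal (h (x + r *\<^sub>R x) * norm x) \<le> ennreal \<dots>" by (rule ennreal_leI)
            then show ?thesis using True \<mu> by (simp add: ennreal_mult ennreal_plus)
          qed simp
        qed
        also have "\<dots> = ennreal (\<mu> * norm x) * ennreal (1 / (\<kappa> - 1)) + ennreal (\<mu> powr (1 - p) * norm x) * X x"
          unfolding X_def using nn_integral_powr_tail[OF \<kappa>, of 1 0]
          by (subst nn_integral_add) (auto simp: nn_integral_cmult)
        also have "\<dots> \<le> ennreal (\<mu> * norm x) * ennreal (1 / (\<kappa> - 1)) + ennreal (\<mu> powr (1 - p) * norm x) * ennreal Y"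
          using Y unfolding real by (intro add_left_mono mult_left_mono ennreal_leI) auto
        also have "\<dots> = ennreal (\<mu> * norm x * (1 / (\<kappa> - 1)) + \<mu> powr (1 - p) * norm x * Y)"
          using \<mu> \<kappa> Y0 by (simp add: ennreal_mult[symmetric] ennreal_plus[symmetric] del: ennreal_plus)
        also have "\<mu> * norm x * (1 / (\<kappa> - 1)) + \<mu> powr (1 - p) * norm x * Y = c * norm x * \<mu>"
        proof -
          have "\<mu> powr (1 - p) * norm x * Y = norm x * (\<mu> powr (1 - p) * Y)" by simp
          then show ?thesis unfolding \<mu>Y c_def by (simp add: algebra_simps)
        qed
        finally have "\<bar>f x\<bar> \<le> c * norm x * \<mu>"
          using c \<mu> by simp
        then have "\<bar>f x\<bar> powr p \<le> (c * norm x * \<mu>) powr p"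
          using p by (intro powr_mono2) auto
        also have "\<dots> = c powr p * norm x powr p * Y powr 1"
          using c \<mu> p Y0 by (simp add: powr_mult \<mu>_def powr_powr)
        finally show "ennreal (\<bar>f x\<bar> powr p) \<le> ennreal (c powr p * norm x powr p * Y powr 1)"
          by (rule ennreal_leI)
      qed (use real in auto)
      then show ?thesis using real by (simp add: ennreal_mult)
    qed
    define F where "F x = ennreal ((norm x powr a * h x) powr p)" for x
    have [measurable]: "F \<in> borel_measurable borel" unfolding F_def by measurable
    \<comment> \<open>The dilation contributes (1+r)^(-a p) from the weight and (1+r)^(-n) from the
      Jacobian; together with (1+r)^(\<kappa> (p-1)) this is (1+r)^(-e).\<close>
    have scaled: "(\<integral>\<^sup>+x. ennreal (norm x powr (a * p)) * ennreal ((1 + r) powr (\<kappa> * (p - 1)) * h (x + r *\<^sub>R x) powr p) \<partial>lborel)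
      \<le> ennreal ((1 + r) powr (- e)) * ennreal N" if r: "r \<ge> 0" for r
    proof -
      have x_eq: "x + r *\<^sub>R x = 0 + (1 + r) *\<^sub>R x" for x :: 'a by (simp add: scaleR_add_left)
      have "(\<integral>\<^sup>+x. ennreal (norm x powr (a * p)) * ennreal ((1 + r) powr (\<kappa> * (p - 1)) * h (x + r *\<^sub>R x) powr p) \<partial>lborel)
        = (\<integral>\<^sup>+x. ennreal ((1 + r) powr (\<kappa> * (p - 1) - a * p)) * F (0 + (1 + r) *\<^sub>R x) \<partial>lborel)"
      proof (intro nn_integral_cong)
        fix x :: 'a
        have "F (0 + (1 + r) *\<^sub>R x) = ennreal ((1 + r) powr (a * p) * norm x powr (a * p) * h (x + r *\<^sub>R x) powr p)"
          unfolding F_def x_eq[symmetric] using r h0[of "x + r *\<^sub>R x"]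
          by (subst x_eq) (simp add: powr_mult powr_powr)
        moreover have "(1 + r) powr (\<kappa> * (p - 1)) = (1 + r) powr (\<kappa> * (p - 1) - a * p) * (1 + r) powr (a * p)"
          by (simp only: powr_add[symmetric] diff_add_cancel)
        ultimately show "ennreal (norm x powr (a * p)) * ennreal ((1 + r) powr (\<kappa> * (p - 1)) * h (x + r *\<^sub>R x) powr p)
          = ennreal ((1 + r) powr (\<kappa> * (p - 1) - a * p)) * F (0 + (1 + r) *\<^sub>R x)"
          by (simp add: ennreal_mult[symmetric] ac_simps)
      qed
      also have "\<dots> = ennreal ((1 + r) powr (\<kappa> * (p - 1) - a * p)) * (\<integral>\<^sup>+x. F (0 + (1 + r) *\<^sub>R x) \<partial>lborel)"
        by (rule nn_integral_cmult) measurable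
      also have "ennreal ((1 + r) powr (\<kappa> * (p - 1) - a * p)) = ennreal ((1 + r) powr (- e)) * ennreal (\<bar>1 + r\<bar> ^ DIM('a))"
        using r by (simp add: ennreal_mult[symmetric] e_def n_def powr_add[symmetric] powr_realpow[symmetric])
      also have "\<dots> * (\<integral>\<^sup>+x. F (0 + (1 + r) *\<^sub>R x) \<partial>lborel) = ennreal ((1 + r) powr (- e)) * (\<integral>\<^sup>+x. F x \<partial>lborel)"
        using r by (subst nn_integral_lborel_affine[of F "1 + r" 0]) (auto simp: mult.assoc)
      also have "\<dots> \<le> ennreal ((1 + r) powr (- e)) * ennreal N"
        using hN unfolding F_def by (intro mult_left_mono) auto
      finally show ?thesis .
    qed
    have "(\<integral>\<^sup>+x. ennreal ((norm x powr (a - 1) * \<bar>f x\<bar>) powr p) \<partial>lborel)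
      \<le> (\<integral>\<^sup>+x. ennreal (c powr p) * (ennreal (norm x powr (a * p)) * X x) \<partial>lborel)"
    proof (intro nn_integral_mono)
      fix x :: 'a
      show "ennreal ((norm x powr (a - 1) * \<bar>f x\<bar>) powr p) \<le> ennreal (c powr p) * (ennreal (norm x powr (a * p)) * X x)"
      \<comment> \<open>\<open>0 powr (a - 1)\<close> is 0, so the left side vanishes at the origin
        even when \<open>a < 1\<close>.\<close>
      proof (cases "x = 0")
        case False
        have "ennreal ((norm x powr (a - 1) * \<bar>f x\<bar>) powr p) = ennreal (norm x powr ((a - 1) * p)) * ennreal (\<bar>f x\<bar> powr p)"
          by (simp add: powr_mult powr_powr ennreal_mult)
        also have "\<dots> \<le> ennreal (norm x powr ((a - 1) * p)) * (ennreal (c powr p * norm x powr p) * X x)"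
          by (intro mult_left_mono pointwise False) auto
        also have "\<dots> = ennreal (norm x powr ((a - 1) * p) * (c powr p * norm x powr p)) * X x"
          by (simp add: ennreal_mult mult.assoc)
        also have "norm x powr ((a - 1) * p) * (c powr p * norm x powr p) = c powr p * norm x powr (a * p)"
          using False by (simp add: left_diff_distrib powr_diff)
        finally show ?thesis by (simp add: ennreal_mult mult.assoc)
      qed simp
    qed
    also have "\<dots> = ennreal (c powr p) * (\<integral>\<^sup>+x. ennreal (norm x powr (a * p)) * X x \<partial>lborel)"
      unfolding X_def by (rule nn_integral_cmult) measurable
    also have "(\<integral>\<^sup>+x. ennreal (norm x powr (a * p)) * X x \<partial>lborel)
      = (\<integral>\<^sup>+x. \<integral>\<^sup>+r. indicator {0..} r * (ennreal (norm x powr (a * p)) * ennreal ((1 + r) powr (\<kappa> * (p - 1)) * h (x + r *\<^sub>R x) powr p)) \<partial>lborel \<partial>lborel)"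
      unfolding X_def by (subst nn_integral_cmult[symmetric]) (auto simp: ac_simps intro!: nn_integral_cong)
    also have "\<dots> = (\<integral>\<^sup>+r. \<integral>\<^sup>+x. indicator {0..} r * (ennreal (norm x powr (a * p)) * ennreal ((1 + r) powr (\<kappa> * (p - 1)) * h (x + r *\<^sub>R x) powr p)) \<partial>lborel \<partial>lborel)"
      by (rule lborel_pair.Fubini'[symmetric]) measurable
    also have "\<dots> \<le> (\<integral>\<^sup>+r. ennreal N * (ennreal ((1 + r) powr (- e)) * indicator {0..} r) \<partial>lborel)"
      using scaled by (intro nn_integral_mono) (auto simp: indicator_def mult.commute)
    also have "\<dots> = ennreal N * ennreal (1 / (e - 1))"
      using nn_integral_powr_tail[OF e, of 1 0] by (simp add: nn_integral_cmult)
    also have "ennreal (c powr p) * (ennreal N * ennreal (1 / (e - 1))) = ennreal (C * N)"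
      using N e by (simp add: C_def ennreal_mult[symmetric])
    finally show "(\<integral>\<^sup>+x. ennreal ((norm x powr (a - 1) * \<bar>f x\<bar>) powr p) \<partial>lborel) \<le> ennreal (C * N)"
      by (simp add: mult_left_mono)
  qed
qed

section \<open>Gradients and bounded approximations of the power weight\<close>

text \<open>Justifies the definite description: the adjoint of the derivative, applied to 1, is its
  Riesz representative, and two candidates would induce the same derivative.\<close>

lemma GDERIV_gradient:
  fixes f :: "'a::euclidean_space \<Rightarrow> real"
  assumes "f differentiable (at x)"
  shows "GDERIV f x :> gradient f x"
proof -
  obtain f' where f': "(f has_derivative f') (at x)"
    using assms by (auto simp: differentiable_def)
  have "h \<bullet> adjoint f' 1 = f' h" for h
    using adjoint_works[OF has_derivative_linear[OF f'], of h 1] by simp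
  then have D: "GDERIV f x :> adjoint f' 1"
    using f' by (simp add: gderiv_def)
  show ?thesis
    unfolding gradient_def
  proof (rule theI[where P = "\<lambda>D. GDERIV f x :> D", OF D])
    fix E assume "GDERIV f x :> E"
    then have "(\<lambda>h. h \<bullet> E) = (\<lambda>h. h \<bullet> adjoint f' 1)"
      using D unfolding gderiv_def by (intro has_derivative_unique)
    then show "E = adjoint f' 1"
      by (metis vector_eq_ldot)
  qed
qed

text \<open>The weight \<open>|x|\<^sup>a\<close> is truncated to \<open>(|x| / (1 + \<epsilon>|x|))\<^sup>a\<close>, which is bounded, so that its
  product with \<open>f\<close> still vanishes at infinity.\<close>

lemma has_derivative_truncated_weight:
  fixes f :: "'a::euclidean_space \<Rightarrow> real"
  assumes \<epsilon>: "\<epsilon> > 0" and a: "a \<ge> 0" and x: "x \<noteq> 0" and f: "f differentiable (at x)"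
  shows "\<exists>D. ((\<lambda>x. (norm x / (1 + \<epsilon> * norm x)) powr a * f x) has_derivative D) (at x) \<and>
    (\<forall>v. \<bar>D v\<bar> \<le> (norm x powr a * norm (gradient f x) + a * (norm x powr (a - 1) * \<bar>f x\<bar>)) * norm v)"
proof -
  define s where "s = norm x"
  have s: "s > 0" using x by (simp add: s_def)
  have d: "1 + \<epsilon> * s > 0" using \<epsilon> s by (simp add: add_pos_pos)
  define w where "w = (s / (1 + \<epsilon> * s)) powr a"
  define w' where "w' = a * (s / (1 + \<epsilon> * s)) powr (a - 1) * (1 / (1 + \<epsilon> * s)\<^sup>2)"
  have q_le: "s / (1 + \<epsilon> * s) \<le> s"
    using \<epsilon> s d by (simp add: divide_le_eq)
  have "((\<lambda>t. (t / (1 + \<epsilon> * t)) powr a) has_real_derivative w') (at s)"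
  proof -
    have "((\<lambda>t. t / (1 + \<epsilon> * t)) has_real_derivative 1 / (1 + \<epsilon> * s)\<^sup>2) (at s)"
      using d by (auto intro!: derivative_eq_intros simp: power2_eq_square)
    then show ?thesis
      using s d unfolding w'_def by (auto intro!: derivative_eq_intros simp: power2_eq_square)
  qed
  then have "((\<lambda>t. (t / (1 + \<epsilon> * t)) powr a) has_derivative (*) w') (at (norm x))"
    by (simp add: has_field_derivative_def s_def)
  from has_derivative_compose[OF has_derivative_norm[OF x] this]
  have "((\<lambda>x. (norm x / (1 + \<epsilon> * norm x)) powr a) has_derivative (\<lambda>v. w' * (v \<bullet> sgn x))) (at x)" .
  moreover have "(f has_derivative (\<lambda>v. v \<bullet> gradient f x)) (at x)"
    using GDERIV_gradient[OF f] by (simp add: gderiv_def)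
  ultimately have "((\<lambda>x. (norm x / (1 + \<epsilon> * norm x)) powr a * f x) has_derivative
    (\<lambda>v. w * (v \<bullet> gradient f x) + w' * (v \<bullet> sgn x) * f x)) (at x)"
    unfolding w_def s_def by (rule has_derivative_mult)
  moreover have "\<bar>w * (v \<bullet> gradient f x) + w' * (v \<bullet> sgn x) * f x\<bar>
    \<le> (s powr a * norm (gradient f x) + a * (s powr (a - 1) * \<bar>f x\<bar>)) * norm v" for v
  proof -
    have w_le: "w \<le> s powr a" and w0: "w \<ge> 0"
      unfolding w_def using q_le s d a by (auto intro!: powr_mono2)
    \<comment> \<open>The powers of 1 + \<epsilon>s are collected before estimating: for a < 1 the
      exponent a-1 is negative and s/(1 + \<epsilon>s) \<le> s would give the wrong direction. The
      collected exponent -(a+1) is negative for every a \<ge> 0, which yields a bound independent of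
      \<open>\<epsilon>\<close>.\<close>
    have "(s / (1 + \<epsilon> * s)) powr (a - 1) * (1 / (1 + \<epsilon> * s)\<^sup>2) = s powr (a - 1) * (1 + \<epsilon> * s) powr (- (a + 1))"
    proof -
      have "(1 + \<epsilon> * s) powr (- (a + 1)) = (1 / (1 + \<epsilon> * s) powr (a - 1)) * (1 / (1 + \<epsilon> * s) powr 2)"
        unfolding powr_minus_divide[symmetric] powr_add[symmetric] by (simp add: algebra_simps)
      then show ?thesis using s d by (simp add: powr_divide)
    qed
    also have "\<dots> \<le> s powr (a - 1) * 1"
    proof (intro mult_left_mono)
      have "(1 + \<epsilon> * s) powr (- (a + 1)) \<le> (1 + \<epsilon> * s) powr 0"
        using a \<epsilon> s by (intro powr_mono) auto
      then show "(1 + \<epsilon> * s) powr (- (a + 1)) \<le> 1" using d by simp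
    qed simp
    finally have "a * ((s / (1 + \<epsilon> * s)) powr (a - 1) * (1 / (1 + \<epsilon> * s)\<^sup>2)) \<le> a * (s powr (a - 1) * 1)"
      by (rule mult_left_mono[OF _ a])
    then have w'_le: "w' \<le> a * s powr (a - 1)" unfolding w'_def by (simp only: mult.assoc mult_1_right)
    have w'0: "w' \<ge> 0" using a by (simp add: w'_def)
    have "\<bar>w * (v \<bullet> gradient f x)\<bar> \<le> s powr a * (norm v * norm (gradient f x))"
      using w_le w0 by (simp add: abs_mult mult_mono Cauchy_Schwarz_ineq2)
    moreover have "\<bar>w' * (v \<bullet> sgn x) * f x\<bar> \<le> a * s powr (a - 1) * (norm v * 1) * \<bar>f x\<bar>"
    proof -
      have "\<bar>v \<bullet> sgn x\<bar> \<le> norm v * 1"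
        using Cauchy_Schwarz_ineq2[of v "sgn x"] x by (simp add: norm_sgn)
      then show ?thesis
        unfolding abs_mult using w'_le w'0 by (intro mult_right_mono mult_mono) auto
    qed
    ultimately show ?thesis by (simp add: algebra_simps)
  qed
  ultimately show ?thesis unfolding s_def by blast
qed

lemma add_powr_le:
  fixes x y p :: real
  assumes "x \<ge> 0" "y \<ge> 0" "p \<ge> 0"
  shows "(x + y) powr p \<le> 2 powr p * (x powr p + y powr p)"
proof -
  have "(x + y) powr p \<le> (2 * max x y) powr p"
    using assms by (intro powr_mono2) auto
  also have "\<dots> = 2 powr p * max x y powr p" using assms by (subst powr_mult) auto
  also have "\<dots> \<le> 2 powr p * (x powr p + y powr p)"
    by (intro mult_left_mono) (auto simp: max_def)
  finally show ?thesis .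
qed

text \<open>All truncations of |x|^a f share one gradient majorant, so the unweighted inequality
  applies to them with a single constant, and Hardy's inequality controls the part of the majorant
  in which the weight is differentiated. Monotone convergence then removes the truncation.\<close>

lemma power_weighted_sobolev_against_weak_weight:
  fixes p q a :: real
  assumes dim: "DIM('a::euclidean_space) \<ge> 2" and p: "1 < p" "p < DIM('a)" and q: "p \<le> q" and a: "a \<ge> 0"
  obtains C where "C > 0"
    "\<And>f N V K. \<lbrakk>f \<in> (C01 :: ('a \<Rightarrow> real) set); N \<ge> 0;
      (\<integral>\<^sup>+x. ennreal ((norm x powr a * norm (gradient f x)) powr p) \<partial>lborel) \<le> ennreal N;
      V \<in> borel_measurable borel; K \<ge> 0;
      \<And>E m. E \<in> sets borel \<Longrightarrow> m > 0 \<Longrightarrow> emeasure lborel E \<le> ennreal m \<Longrightarrow>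
        (\<integral>\<^sup>+x. V x * indicator E x \<partial>lborel) \<le> ennreal (K * m powr (q * (1 / p - 1 / DIM('a))))\<rbrakk>
      \<Longrightarrow> (\<integral>\<^sup>+x. ennreal ((norm x powr a * \<bar>f x\<bar>) powr q) * V x \<partial>lborel) \<le> ennreal (C * K * N powr (q / p))"
proof -
  obtain C1 where C1: "C1 > 0"
    "\<And>G H D N V K. \<lbrakk>\<And>x::'a. x \<noteq> 0 \<Longrightarrow> (G has_derivative D x) (at x);
      \<And>x v. x \<noteq> 0 \<Longrightarrow> \<bar>D x v\<bar> \<le> H x * norm v; continuous_on (- {0}) H; \<And>x. H x \<ge> 0;
      (G \<longlongrightarrow> 0) at_infinity; N \<ge> 0; (\<integral>\<^sup>+x. ennreal (H x powr p) \<partial>lborel) \<le> ennreal N;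
      V \<in> borel_measurable borel; K \<ge> 0;
      \<And>E m. E \<in> sets borel \<Longrightarrow> m > 0 \<Longrightarrow> emeasure lborel E \<le> ennreal m \<Longrightarrow>
        (\<integral>\<^sup>+x. V x * indicator E x \<partial>lborel) \<le> ennreal (K * m powr (q * (1 / p - 1 / DIM('a))))\<rbrakk>
      \<Longrightarrow> (\<integral>\<^sup>+x. ennreal (\<bar>G x\<bar> powr q) * V x \<partial>lborel) \<le> ennreal (C1 * K * N powr (q / p))"
    using sobolev_against_weak_weight[OF dim p q] by blast
  obtain C2 where C2: "C2 > 0"
    "\<And>f D h N. \<lbrakk>\<And>x::'a. (f has_derivative D x) (at x);
      \<And>x v. \<bar>D x v\<bar> \<le> h x * norm v; continuous_on UNIV h; \<And>x. h x \<ge> 0;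
      (f \<longlongrightarrow> 0) at_infinity; N \<ge> 0;
      (\<integral>\<^sup>+x. ennreal ((norm x powr a * h x) powr p) \<partial>lborel) \<le> ennreal N\<rbrakk>
      \<Longrightarrow> (\<integral>\<^sup>+x. ennreal ((norm x powr (a - 1) * \<bar>f x\<bar>) powr p) \<partial>lborel) \<le> ennreal (C2 * N)"
    using weighted_hardy_inequality[OF p a] by blast
  \<comment> \<open>\<open>2 powr p\<close> comes from \<open>add_powr_le\<close>, and
    \<open>a powr p * C2\<close> from Hardy's inequality for the term with the differentiated
    weight.\<close>
  define C3 where "C3 = 2 powr p * (1 + a powr p * C2)"
  have C3: "C3 > 0" using C2(1) by (simp add: C3_def add_pos_nonneg)
  define C where "C = C1 * C3 powr (q / p)"
  have C: "C > 0" using C1(1) C3 by (simp add: C_def)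
  show ?thesis
  proof (rule that[OF C])
    fix f :: "'a \<Rightarrow> real" and N K :: real and V :: "'a \<Rightarrow> ennreal"
    assume f: "f \<in> C01" and N: "N \<ge> 0"
      and fN: "(\<integral>\<^sup>+x. ennreal ((norm x powr a * norm (gradient f x)) powr p) \<partial>lborel) \<le> ennreal N"
      and V[measurable]: "V \<in> borel_measurable borel" and K: "K \<ge> 0"
      and VK: "\<And>E m. E \<in> sets borel \<Longrightarrow> m > 0 \<Longrightarrow> emeasure lborel E \<le> ennreal m \<Longrightarrow>
        (\<integral>\<^sup>+x. V x * indicator E x \<partial>lborel) \<le> ennreal (K * m powr (q * (1 / p - 1 / DIM('a))))"
    have diff: "f differentiable (at x)" for x using f by (auto simp: C01_def)
    have grad: "continuous_on UNIV (gradient f)" and lim: "(f \<longlongrightarrow> 0) at_infinity"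
      using f by (auto simp: C01_def)
    have f_cont: "continuous_on UNIV f"
      using diff by (intro continuous_at_imp_continuous_on) (auto intro: differentiable_imp_continuous_within)
    have [measurable]: "f \<in> borel_measurable borel" "gradient f \<in> borel_measurable borel"
      using f_cont grad by (auto intro: borel_measurable_continuous_onI)
    have hardy: "(\<integral>\<^sup>+x. ennreal ((norm x powr (a - 1) * \<bar>f x\<bar>) powr p) \<partial>lborel) \<le> ennreal (C2 * N)"
    proof (rule C2(2)[where D = "\<lambda>x v. v \<bullet> gradient f x" and h = "\<lambda>x. norm (gradient f x)"])
      show "(f has_derivative (\<lambda>v. v \<bullet> gradient f x)) (at x)" for x
        using GDERIV_gradient[OF diff[of x]] by (simp add: gderiv_def)
      show "\<bar>v \<bullet> gradient f x\<bar> \<le> norm (gradient f x) * norm v" for x v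
        using Cauchy_Schwarz_ineq2[of v "gradient f x"] by (simp add: mult.commute)
    qed (use grad lim N fN in \<open>auto intro!: continuous_intros\<close>)
    define H where "H x = norm x powr a * norm (gradient f x) + a * (norm x powr (a - 1) * \<bar>f x\<bar>)" for x
    have H0: "H x \<ge> 0" for x using a by (simp add: H_def)
    have HN: "(\<integral>\<^sup>+x. ennreal (H x powr p) \<partial>lborel) \<le> ennreal (C3 * N)"
    proof -
      have "(\<integral>\<^sup>+x. ennreal (H x powr p) \<partial>lborel)
        \<le> (\<integral>\<^sup>+x. ennreal (2 powr p) * (ennreal ((norm x powr a * norm (gradient f x)) powr p)
          + ennreal (a powr p) * ennreal ((norm x powr (a - 1) * \<bar>f x\<bar>) powr p)) \<partial>lborel)"
      proof (intro nn_integral_mono)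
        fix x
        have "H x powr p \<le> 2 powr p * ((norm x powr a * norm (gradient f x)) powr p
          + (a * (norm x powr (a - 1) * \<bar>f x\<bar>)) powr p)"
          unfolding H_def using a p by (intro add_powr_le) auto
        also have "(a * (norm x powr (a - 1) * \<bar>f x\<bar>)) powr p = a powr p * (norm x powr (a - 1) * \<bar>f x\<bar>) powr p"
          using a by (subst powr_mult) auto
        finally have "ennreal (H x powr p) \<le> ennreal (2 powr p * ((norm x powr a * norm (gradient f x)) powr p
          + a powr p * (norm x powr (a - 1) * \<bar>f x\<bar>) powr p))"
          by (rule ennreal_leI)
        then show "ennreal (H x powr p) \<le> ennreal (2 powr p) * (ennreal ((norm x powr a * norm (gradient f x)) powr p)
          + ennreal (a powr p) * ennreal ((norm x powr (a - 1) * \<bar>f x\<bar>) powr p))"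
          by (simp add: ennreal_mult ennreal_plus)
      qed
      also have "\<dots> = ennreal (2 powr p) * ((\<integral>\<^sup>+x. ennreal ((norm x powr a * norm (gradient f x)) powr p) \<partial>lborel)
          + ennreal (a powr p) * (\<integral>\<^sup>+x. ennreal ((norm x powr (a - 1) * \<bar>f x\<bar>) powr p) \<partial>lborel))"
        by (simp add: nn_integral_cmult nn_integral_add)
      also have "\<dots> \<le> ennreal (2 powr p) * (ennreal N + ennreal (a powr p) * ennreal (C2 * N))"
        by (intro mult_left_mono add_mono fN hardy) auto
      also have "\<dots> = ennreal (2 powr p * (N + a powr p * (C2 * N)))"
        using N C2(1) by (simp add: ennreal_mult ennreal_plus)
      also have "2 powr p * (N + a powr p * (C2 * N)) = C3 * N"
        by (simp add: C3_def algebra_simps)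
      finally show ?thesis .
    qed
    \<comment> \<open>A decreasing null sequence, so that \<open>\<omega> i x\<close> increases to
      |x|^a at every x \<noteq> 0.\<close>
    define \<epsilon> where "\<epsilon> i = 1 / real (Suc i)" for i
    have \<epsilon>: "\<epsilon> i > 0" for i by (simp add: \<epsilon>_def)
    define \<omega> where "\<omega> i x = (norm x / (1 + \<epsilon> i * norm x)) powr a" for i and x :: 'a
    have \<omega>_den: "1 + \<epsilon> i * norm x > 0" for i and x :: 'a
      using \<epsilon>[of i] by (simp add: add_pos_nonneg)
    have truncated: "(\<integral>\<^sup>+x. ennreal (\<bar>\<omega> i x * f x\<bar> powr q) * V x \<partial>lborel) \<le> ennreal (C1 * K * (C3 * N) powr (q / p))" for i
    proof -
      have "\<exists>D. \<forall>x. x \<noteq> 0 \<longrightarrow> ((\<lambda>x. \<omega> i x * f x) has_derivative D x) (at x) \<and> (\<forall>v. \<bar>D x v\<bar> \<le> H x * norm v)"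
        unfolding H_def \<omega>_def
        by (intro choice allI) (use has_derivative_truncated_weight[OF \<epsilon> a _ diff] in blast)
      then obtain D where D: "\<And>x. x \<noteq> 0 \<Longrightarrow> ((\<lambda>x. \<omega> i x * f x) has_derivative D x) (at x)"
        "\<And>x v. x \<noteq> 0 \<Longrightarrow> \<bar>D x v\<bar> \<le> H x * norm v"
        by blast
      have "((\<lambda>x. \<omega> i x * f x) \<longlongrightarrow> 0) at_infinity"
      proof (rule Lim_null_comparison)
        show "\<forall>\<^sub>F x in at_infinity. norm (\<omega> i x * f x) \<le> (1 / \<epsilon> i) powr a * \<bar>f x\<bar>"
        proof (intro always_eventually allI)
          fix x :: 'a
          have "norm x / (1 + \<epsilon> i * norm x) \<le> 1 / \<epsilon> i"
            using \<epsilon>[of i] \<omega>_den[of i x] by (simp add: divide_simps)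
          then have "\<omega> i x \<le> (1 / \<epsilon> i) powr a"
            unfolding \<omega>_def using a \<omega>_den[of i x] by (intro powr_mono2) auto
          moreover have "\<omega> i x \<ge> 0" by (simp add: \<omega>_def)
          ultimately show "norm (\<omega> i x * f x) \<le> (1 / \<epsilon> i) powr a * \<bar>f x\<bar>"
            by (simp add: abs_mult mult_right_mono)
        qed
        show "((\<lambda>x. (1 / \<epsilon> i) powr a * \<bar>f x\<bar>) \<longlongrightarrow> 0) at_infinity"
          using tendsto_mult_right_zero[OF tendsto_rabs_zero[OF lim]] .
      qed
      moreover have "continuous_on (- {0}) H"
        unfolding H_def
        by (intro continuous_intros continuous_on_subset[OF grad] continuous_on_subset[OF f_cont]) auto
      ultimately show ?thesis
        using C3 N by (intro C1(2)[OF D _ H0 _ _ HN V K VK]) auto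
    qed
    have \<omega>_mono: "\<omega> i x \<le> \<omega> (Suc i) x" for i x
    proof -
      have "\<epsilon> (Suc i) \<le> \<epsilon> i" by (simp add: \<epsilon>_def frac_le)
      then have "1 + \<epsilon> (Suc i) * norm x \<le> 1 + \<epsilon> i * norm x" by (simp add: mult_right_mono)
      then have "norm x / (1 + \<epsilon> i * norm x) \<le> norm x / (1 + \<epsilon> (Suc i) * norm x)"
        using \<omega>_den[of "Suc i" x] by (intro divide_left_mono mult_pos_pos \<omega>_den) auto
      then show ?thesis unfolding \<omega>_def using a \<omega>_den[of i x] by (intro powr_mono2) auto
    qed
    have inc: "ennreal (\<bar>\<omega> i x * f x\<bar> powr q) \<le> ennreal (\<bar>\<omega> (Suc i) x * f x\<bar> powr q)" for i x
    proof -
      have "\<omega> i x \<ge> 0" by (simp add: \<omega>_def)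
      then have "\<bar>\<omega> i x * f x\<bar> \<le> \<bar>\<omega> (Suc i) x * f x\<bar>"
        unfolding abs_mult using \<omega>_mono[of i x] by (intro mult_right_mono) auto
      then show ?thesis using p q by (intro ennreal_leI powr_mono2) auto
    qed
    have SUP: "(SUP i. ennreal (\<bar>\<omega> i x * f x\<bar> powr q)) = ennreal ((norm x powr a * \<bar>f x\<bar>) powr q)" if x: "x \<noteq> 0" for x
    proof -
      have "\<epsilon> \<longlonglongrightarrow> 0" unfolding \<epsilon>_def by real_asymp
      then have "(\<lambda>i. norm x / (1 + \<epsilon> i * norm x)) \<longlonglongrightarrow> norm x / (1 + 0 * norm x)"
        by (intro tendsto_intros) auto
      then have "(\<lambda>i. \<omega> i x) \<longlonglongrightarrow> norm x powr a"
        unfolding \<omega>_def using x by (intro tendsto_powr) auto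
      then have "(\<lambda>i. \<bar>\<omega> i x * f x\<bar>) \<longlonglongrightarrow> \<bar>norm x powr a * f x\<bar>"
        by (intro tendsto_rabs tendsto_mult tendsto_const)
      then have "(\<lambda>i. \<bar>\<omega> i x * f x\<bar> powr q) \<longlonglongrightarrow> \<bar>norm x powr a * f x\<bar> powr q"
        using p q by (intro tendsto_powr') auto
      then have "(\<lambda>i. ennreal (\<bar>\<omega> i x * f x\<bar> powr q)) \<longlonglongrightarrow> ennreal (\<bar>norm x powr a * f x\<bar> powr q)"
        by (rule tendsto_ennrealI)
      moreover have "(\<lambda>i. ennreal (\<bar>\<omega> i x * f x\<bar> powr q)) \<longlonglongrightarrow> (SUP i. ennreal (\<bar>\<omega> i x * f x\<bar> powr q))"
        by (intro LIMSEQ_SUP incseq_SucI inc)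
      ultimately show ?thesis by (simp add: LIMSEQ_unique abs_mult)
    qed
    have "(\<integral>\<^sup>+x. ennreal ((norm x powr a * \<bar>f x\<bar>) powr q) * V x \<partial>lborel)
      \<le> (\<integral>\<^sup>+x. (SUP i. ennreal (\<bar>\<omega> i x * f x\<bar> powr q) * V x) \<partial>lborel)"
    proof (intro nn_integral_mono)
      fix x :: 'a
      show "ennreal ((norm x powr a * \<bar>f x\<bar>) powr q) * V x \<le> (SUP i. ennreal (\<bar>\<omega> i x * f x\<bar> powr q) * V x)"
        \<comment> \<open>At the origin the left side is 0, also for \<open>a = 0\<close>, because
          \<open>0 powr 0 = 0\<close>.\<close>
        using SUP[of x] by (cases "x = 0") (auto simp: SUP_mult_right_ennreal[symmetric])
    qed
    also have "\<dots> = (SUP i. \<integral>\<^sup>+x. ennreal (\<bar>\<omega> i x * f x\<bar> powr q) * V x \<partial>lborel)"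
      unfolding \<omega>_def
      by (intro nn_integral_monotone_convergence_SUP incseq_SucI le_funI mult_right_mono
          inc[unfolded \<omega>_def]) auto
    also have "\<dots> \<le> ennreal (C1 * K * (C3 * N) powr (q / p))"
      by (intro SUP_least truncated)
    also have "C1 * K * (C3 * N) powr (q / p) = C * K * N powr (q / p)"
      using C3 N by (simp add: C_def powr_mult)
    finally show "(\<integral>\<^sup>+x. ennreal ((norm x powr a * \<bar>f x\<bar>) powr q) * V x \<partial>lborel) \<le> ennreal (C * K * N powr (q / p))" .
  qed
qed

section \<open>Combining the maximal function bound with the weighted inequality\<close>

text \<open>Covers \<open>g\<close> vanishing almost everywhere, a case outside the majorant
  construction, which divides by the norm of \<open>g\<close>.\<close>

lemma hl_maximal_eq_0:
  assumes g: "integrable lebesgue g" "(LINT x|lebesgue. \<bar>g x\<bar>) = 0"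
  shows "hl_maximal g x = 0"
proof -
  have *: "(\<integral>\<^sup>+y. ennreal \<bar>g y\<bar> \<partial>lebesgue) = 0"
    using g by (subst nn_integral_eq_integral) auto
  have "(\<integral>\<^sup>+y\<in>Q. ennreal \<bar>g y\<bar> \<partial>lebesgue) \<le> (\<integral>\<^sup>+y. ennreal \<bar>g y\<bar> \<partial>lebesgue)" for Q
    by (intro nn_integral_mono) (auto simp: indicator_def)
  then have "(\<integral>\<^sup>+y\<in>Q. ennreal \<bar>g y\<bar> \<partial>lebesgue) = 0" for Q
    unfolding * by simp
  then have "hl_maximal g x \<le> 0"
    unfolding hl_maximal_def by (intro SUP_least) simp
  then show ?thesis by simp
qed

theorem corollary6p9:
  fixes p q \<delta> :: real
  assumes "CARD('n::finite) > 1"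
    and "1 < p" and "p \<le> q"
    and "Theta1 CARD('n) p q > 0"
    and "q < real CARD('n) / Theta1 CARD('n) p q"
    and "0 \<le> \<delta>" and "\<delta> < real CARD('n) * (p - 1)"
  shows "\<exists>C>0. \<forall>f \<in> (C01 :: (real ^ 'n \<Rightarrow> real) set). \<forall>g :: real ^ 'n \<Rightarrow> real.
    integrable lebesgue g \<longrightarrow>
    ennreal_powr
      (\<integral>\<^sup>+ x. ennreal (\<bar>f x\<bar> powr q)
             * ennreal_powr (hl_maximal g x) (Theta1 CARD('n) p q * q / real CARD('n))
             * ennreal (norm x powr (q * \<delta> / p)) \<partial>lebesgue)
      (1 / q)
    \<le> ennreal (C * (LINT x|lebesgue. \<bar>g x\<bar>) powr (Theta1 CARD('n) p q / real CARD('n)))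
      * ennreal_powr (\<integral>\<^sup>+ x. ennreal (norm (gradient f x) powr p * norm x powr \<delta>) \<partial>lebesgue)
          (1 / p)"
proof -
  define n where "n = real CARD('n)"
  define \<Theta> where "\<Theta> = Theta1 CARD('n) p q"
  define \<gamma> where "\<gamma> = \<Theta> * q / n"
  define a where "a = \<delta> / p"
  have n: "n \<ge> 2" using assms(1) by (simp add: n_def)
  have p: "p > 1" "p > 0" and q: "q > 0" "p \<le> q" using assms by auto
  have \<Theta>: "\<Theta> > 0" using assms by (simp add: \<Theta>_def)
  have \<gamma>: "0 < \<gamma>" "\<gamma> < 1"
    using \<Theta> q n assms(5) by (auto simp: \<gamma>_def n_def[symmetric] \<Theta>_def[symmetric] field_simps)
  \<comment> \<open>This identity makes the power of \<open>m\<close> in Kolmogorov's bound the one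
    that the inequality against weak weights expects.\<close>
  have \<gamma>_eq: "1 - \<gamma> = q * (1 / p - 1 / n)"
    using p q n by (simp add: \<gamma>_def \<Theta>_def Theta1_def n_def[symmetric] field_simps)
  have "1 / p - 1 / n > 0" using \<gamma>(2) \<gamma>_eq q by (metis diff_gt_0_iff_gt zero_less_mult_pos)
  then have pn: "p < n" using p n by (simp add: field_simps)
  have dim: "DIM(real ^ 'n) \<ge> 2" "p < DIM(real ^ 'n)" using n pn by (auto simp: n_def)
  have a: "a \<ge> 0" using assms p by (simp add: a_def)
  obtain C where C: "C > 0"
    "\<And>f N V K. \<lbrakk>f \<in> (C01 :: (real ^ 'n \<Rightarrow> real) set); N \<ge> 0;
      (\<integral>\<^sup>+x. ennreal ((norm x powr a * norm (gradient f x)) powr p) \<partial>lborel) \<le> ennreal N;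
      V \<in> borel_measurable borel; K \<ge> 0;
      \<And>E m. E \<in> sets borel \<Longrightarrow> m > 0 \<Longrightarrow> emeasure lborel E \<le> ennreal m \<Longrightarrow>
        (\<integral>\<^sup>+x. V x * indicator E x \<partial>lborel) \<le> ennreal (K * m powr (q * (1 / p - 1 / DIM(real ^ 'n))))\<rbrakk>
      \<Longrightarrow> (\<integral>\<^sup>+x. ennreal ((norm x powr a * \<bar>f x\<bar>) powr q) * V x \<partial>lborel) \<le> ennreal (C * K * N powr (q / p))"
    using power_weighted_sobolev_against_weak_weight[OF dim(1) p(1) dim(2) q(2) a] by blast
  obtain K where K: "K > 0"
    "\<And>g :: real ^ 'n \<Rightarrow> real. integrable lebesgue g \<Longrightarrow> (LINT x|lebesgue. \<bar>g x\<bar>) > 0 \<Longrightarrow>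
      \<exists>V \<in> borel_measurable borel. (\<forall>x. ennreal_powr (hl_maximal g x) \<gamma> \<le> V x) \<and>
        (\<forall>E m. E \<in> sets borel \<longrightarrow> m > 0 \<longrightarrow> emeasure lborel E \<le> ennreal m \<longrightarrow>
          (\<integral>\<^sup>+x. V x * indicator E x \<partial>lborel)
            \<le> ennreal (K * (LINT x|lebesgue. \<bar>g x\<bar>) powr \<gamma> * m powr (1 - \<gamma>)))"
    using hl_maximal_powr_majorant[OF \<gamma>, where 'n = 'n] by blast
  \<comment> \<open>A q-th root, as the inequality was proved for q-th powers; the norm of
    \<open>g\<close> then gets the exponent \<gamma>/q = \<Theta>/n.\<close>
  define B where "B = (C * K) powr (1 / q)"
  have B: "B > 0" using C(1) K(1) by (simp add: B_def)
  have powr_mono_ennreal: "ennreal_powr x (1 / q) \<le> ennreal (r powr (1 / q))" if "x \<le> ennreal r" "r \<ge> 0" for x r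
    using that q by (cases x) (auto simp: ennreal_powr_def top_unique intro!: ennreal_leI powr_mono2)
  show ?thesis
  proof (intro exI[of _ B] conjI B ballI allI impI)
    fix f :: "real ^ 'n \<Rightarrow> real" and g :: "real ^ 'n \<Rightarrow> real"
    assume f: "f \<in> C01" and g: "integrable lebesgue g"
    define A where "A = (LINT x|lebesgue. \<bar>g x\<bar>)"
    define J where "J = (\<integral>\<^sup>+ x. ennreal (norm (gradient f x) powr p * norm x powr \<delta>) \<partial>lebesgue)"
    define L where "L = (\<integral>\<^sup>+ x. ennreal (\<bar>f x\<bar> powr q) * ennreal_powr (hl_maximal g x) \<gamma>
             * ennreal (norm x powr (q * \<delta> / p)) \<partial>lebesgue)"
    have "A \<ge> 0" by (simp add: A_def)
    then consider "A = 0" | "A > 0" by linarith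
    then have "ennreal_powr L (1 / q) \<le> ennreal (B * A powr (\<Theta> / n)) * ennreal_powr J (1 / p)"
    proof cases
      case 1
      then have "L = 0"
        unfolding L_def using g \<gamma> by (simp add: A_def hl_maximal_eq_0 ennreal_powr_def)
      then show ?thesis by (simp add: ennreal_powr_def)
    next
      case 2
      show ?thesis
      proof (cases J)
        case top
        \<comment> \<open>The factor in front of the infinite gradient integral is positive, so the
          right side is infinite.\<close>
        then show ?thesis using 2 B by (simp add: ennreal_powr_def ennreal_mult_top)
      next
        case (real N)
        obtain V where V: "V \<in> borel_measurable borel" "\<And>x. ennreal_powr (hl_maximal g x) \<gamma> \<le> V x"
          "\<And>E m. E \<in> sets borel \<Longrightarrow> m > 0 \<Longrightarrow> emeasure lborel E \<le> ennreal m \<Longrightarrow>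
          (\<integral>\<^sup>+x. V x * indicator E x \<partial>lborel) \<le> ennreal (K * A powr \<gamma> * m powr (1 - \<gamma>))"
          using K(2)[OF g] 2 unfolding A_def by blast
        have "(norm x powr a * norm (gradient f x)) powr p = norm (gradient f x) powr p * norm x powr \<delta>" for x
          using p by (simp add: a_def powr_mult powr_powr mult.commute)
        then have JN: "(\<integral>\<^sup>+x. ennreal ((norm x powr a * norm (gradient f x)) powr p) \<partial>lborel) \<le> ennreal N"
          using real by (simp add: J_def nn_integral_completion)
        \<comment> \<open>The nonnegative integral is a supremum over simple functions below the
          integrand and agrees for a measure and its completion, whatever the integrand. This
          permits comparison with the Borel majorant \<open>V\<close> over
          \<open>lborel\<close>.\<close>
        have "L = (\<integral>\<^sup>+ x. ennreal (\<bar>f x\<bar> powr q) * ennreal_powr (hl_maximal g x) \<gamma>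
             * ennreal (norm x powr (q * \<delta> / p)) \<partial>lborel)"
          unfolding L_def by (rule nn_integral_completion)
        also have "\<dots> \<le> (\<integral>\<^sup>+x. ennreal ((norm x powr a * \<bar>f x\<bar>) powr q) * V x \<partial>lborel)"
        proof (intro nn_integral_mono)
          fix x :: "real ^ 'n"
          have "ennreal ((norm x powr a * \<bar>f x\<bar>) powr q) = ennreal (\<bar>f x\<bar> powr q) * ennreal (norm x powr (q * \<delta> / p))"
            by (simp add: a_def powr_mult powr_powr ennreal_mult[symmetric] mult.commute)
          then have "ennreal ((norm x powr a * \<bar>f x\<bar>) powr q) * V x
            = ennreal (\<bar>f x\<bar> powr q) * V x * ennreal (norm x powr (q * \<delta> / p))"
            by (simp add: ac_simps)
          then show "ennreal (\<bar>f x\<bar> powr q) * ennreal_powr (hl_maximal g x) \<gamma> * ennreal (norm x powr (q * \<delta> / p))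
            \<le> ennreal ((norm x powr a * \<bar>f x\<bar>) powr q) * V x"
            using V(2) by (auto intro!: mult_right_mono mult_left_mono)
        qed
        also have "\<dots> \<le> ennreal (C * (K * A powr \<gamma>) * N powr (q / p))"
          using K(1) real V(3) \<gamma>_eq by (intro C(2) f JN V(1)) (auto simp: n_def)
        finally have "ennreal_powr L (1 / q) \<le> ennreal ((C * (K * A powr \<gamma>) * N powr (q / p)) powr (1 / q))"
          using C(1) K(1) by (intro powr_mono_ennreal) auto
        also have "(C * (K * A powr \<gamma>) * N powr (q / p)) powr (1 / q) = B * A powr (\<Theta> / n) * N powr (1 / p)"
          using C(1) K(1) q by (simp add: B_def \<gamma>_def powr_mult powr_powr)
        also have "ennreal \<dots> = ennreal (B * A powr (\<Theta> / n)) * ennreal_powr J (1 / p)"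
          using B real by (simp add: ennreal_powr_def ennreal_mult)
        finally show ?thesis .
      qed
    qed
    then show "ennreal_powr
      (\<integral>\<^sup>+ x. ennreal (\<bar>f x\<bar> powr q)
             * ennreal_powr (hl_maximal g x) (Theta1 CARD('n) p q * q / real CARD('n))
             * ennreal (norm x powr (q * \<delta> / p)) \<partial>lebesgue)
      (1 / q)
    \<le> ennreal (B * (LINT x|lebesgue. \<bar>g x\<bar>) powr (Theta1 CARD('n) p q / real CARD('n)))
      * ennreal_powr (\<integral>\<^sup>+ x. ennreal (norm (gradient f x) powr p * norm x powr \<delta>) \<partial>lebesgue)
          (1 / p)"
      unfolding L_def J_def A_def \<gamma>_def \<Theta>_def n_def .
  qed
qed

end
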